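(* Let $\mathcal M$ be a finite-dimensional manifold of class $C^1$, let $m\ge1$ be an integer, and let $F\colon\mathcal M\rightrightarrows\mathbb R^m$ be an upper semi-continuous set-valued map taking non-empty closed values. Let $x_*\in\mathcal M$, $y_*\in F(x_* )$, and let $\Lambda\subset\mathrm{Lin}(T_{x_*}\mathcal M,\mathbb R^m)$ be a non-empty compact and convex set. Let $V\subset\mathcal M$ be a neighborhood of $x_*$ (endowed with a Riemannian distance $d\colon V\times V\to\mathbb R$) and, for each $j\in\mathbb N$, let $F_j\colon V\rightrightarrows\mathbb R^m$ be a set-valued map such that: (i) for each $j\in\mathbb N$, $F_j$ is upper semi-continuous and takes non-empty compact and convex values; (ii) the sequence $\{F_j\}_{j\in\mathbb N}$ inward graph converges to $F$ (on $V$); (iii) for each $j\in\mathbb N$, the inequality $$\inf\{|y-y_*-L(x-x_* )|: (y,L)\in F_j(x)\times\Lambda\}\le d(x,x_* )\,\tilde\omega_j(d(x,x_* ))$$ holds for every $x\in V$, where $\{\tilde\omega_j\}_{j\in\mathbb N}$ is a sequence of functions $\tilde\omega_j\colon[0,+\infty)\to[0,+\infty)$ which, as $j\to\infty$, converges uniformly on an interval $[0,r]$, for some real number $r>0$, to some modulus $\tilde\omega$. Then $\Lambda$ is a generalized differential quotient (GDQ) of $F$ at $(x_*,y_* )$ in the direction of $\mathcal M$.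
   Context: $\mathrm{Lin}(X,Y)$ is the space of linear maps $X\to Y$ (with operator norm). A modulus is a function $\omega\colon[0,+\infty)\to[0,+\infty)$ that is increasing, with $\omega(0)=0$ and $\lim_{s\downarrow0}\omega(s)=0$. A set-valued map $\Phi\colon X\rightrightarrows Y$ is upper semi-continuous at $x$ if for every neighborhood $\mathcal O_2$ of $\Phi(x)$ there is a neighborhood $\mathcal O_1$ of $x$ with $\Phi(\mathcal O_1)\subset\mathcal O_2$. Its graph is $\mathrm{Gr}(\Phi)=\{(x,y): y\in\Phi(x)\}$. The expression $x-x_*$ is understood in local coordinates: $V$ is contained in the domain of a chart, $V$ is identified with its image in $\mathbb R^n$, and $T_{x_*}\mathcal M$ with $\mathbb R^n$. **Inward graph convergence.** Set-valued maps $F_j\colon X\rightrightarrows Y$ between metric spaces inward graph converge to $F\colon X\rightrightarrows Y$ if for every non-empty open $\Omega\subset X\times Y$ with $\mathrm{Gr}(F)\subset\Omega$ there is $j_\Omega\in\mathbb N$ with $\mathrm{Gr}(F_j)\subset\Omega$ for all $j\ge j_\Omega$. In (ii) this is applied with $X=V$ to $F_j$ and $F|_V$. **CCA maps.** A set-valued map $G\colon X\rightrightarrows Y$ between metric spaces is Cellina continuously approximable (CCA) if for every non-empty compact $K\subset X$ the restriction $G|_K$ has compact graph and is the limit, in the sense of inward graph convergence, of a sequence of continuous single-valued maps $K\to Y$. **GDQ.** Let $F\colon\mathbb R^n\rightrightarrows\mathbb R^m$ be a set-valued map (possibly with empty values), $y_*\in F(x_* )$, $\Lambda\subset\mathrm{Lin}(\mathbb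 R^n,\mathbb R^m)$ non-empty compact, $S\subset\mathbb R^n$ non-empty. $\Lambda$ is a GDQ of $F$ at $(x_*,y_* )$ in the direction of $S$ if for every $\delta>0$ there exist $U,G$ such that: $U$ is a compact neighborhood of $\mathbf 0$ in $\mathbb R^n$ with $(x_*+U)\cap S$ compact; $G$ is a CCA set-valued map from $(x_*+U)\cap S$ to $\Lambda^\delta:=\{A:\inf_{L\in\Lambda}|A-L|\le\delta\}$; and $y_*+L(x-x_* )\in F(x)$ for every $x\in(x_*+U)\cap S$ and $L\in G(x)$. For $F\colon\mathcal M\rightrightarrows\mathcal N$ between $C^1$ manifolds, $S\subset\mathcal M$, $y_*\in F(x_* )$, and charts $(U,\phi)$, $(V',\psi)$ centered at $x_*$, $y_*$, a set $\Lambda\subset\mathrm{Lin}(T_{x_*}\mathcal M,T_{y_*}\mathcal N)$ is a GDQ of $F$ at $(x_*,y_* )$ in the direction of $S$ if $D\psi(y_* )\circ\Lambda\circ D\phi(x_* )^{-1}$ is a GDQ of $\psi\circ F\circ\phi^{-1}$ at $(\mathbf 0,\mathbf 0)$ in the direction of $\phi(U\cap S)$ (independent of the charts). *)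

theory Defs
  imports "HOL-Analysis.Analysis"
begin

section \<open>Set-valued maps\<close>

text \<open>A set-valued map from a set \<open>X\<close> is a function \<open>'a \<Rightarrow> 'b set\<close> of which only the values
  on \<open>X\<close> matter.\<close>

definition gr :: "'a set \<Rightarrow> ('a \<Rightarrow> 'b set) \<Rightarrow> ('a \<times> 'b) set" where
  "gr X F = {(x, y). x \<in> X \<and> y \<in> F x}"

definition usc_on ::
  "'a::topological_space set \<Rightarrow> ('a \<Rightarrow> 'b::topological_space set) \<Rightarrow> bool" where
  "usc_on X F \<longleftrightarrow> (\<forall>x\<in>X. \<forall>O2. open O2 \<and> F x \<subseteq> O2 \<longrightarrow>
     (\<exists>O1. open O1 \<and> x \<in> O1 \<and> (\<Union>z\<in>O1 \<inter> X. F z) \<subseteq> O2))"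

text \<open>The open sets are those of the space \<open>X \<times> Y\<close> itself, not of the ambient types.\<close>

definition inward_graph_converges ::
  "'a::topological_space set \<Rightarrow> 'b::topological_space set \<Rightarrow>
     (nat \<Rightarrow> 'a \<Rightarrow> 'b set) \<Rightarrow> ('a \<Rightarrow> 'b set) \<Rightarrow> bool" where
  "inward_graph_converges X Y Fs F \<longleftrightarrow>
     (\<forall>\<Omega>. openin (top_of_set (X \<times> Y)) \<Omega> \<and> \<Omega> \<noteq> {} \<and> gr X F \<subseteq> \<Omega> \<longrightarrow>
        (\<exists>N. \<forall>j\<ge>N. gr X (Fs j) \<subseteq> \<Omega>))"

definition CCA ::
  "'a::metric_space set \<Rightarrow> 'b::metric_space set \<Rightarrow> ('a \<Rightarrow> 'b set) \<Rightarrow> bool" where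
  "CCA X Y G \<longleftrightarrow> (\<forall>x\<in>X. G x \<subseteq> Y) \<and>
     (\<forall>K. compact K \<and> K \<noteq> {} \<and> K \<subseteq> X \<longrightarrow>
        compact (gr K G) \<and>
        (\<exists>g. (\<forall>k. continuous_on K (g k) \<and> g k ` K \<subseteq> Y) \<and>
             inward_graph_converges K Y (\<lambda>k x. {g k x}) G))"

definition modulus :: "(real \<Rightarrow> real) \<Rightarrow> bool" where
  "modulus \<omega> \<longleftrightarrow> (\<forall>s\<ge>0. \<omega> s \<ge> 0) \<and> mono_on {0..} \<omega> \<and> \<omega> 0 = 0 \<and> (\<omega> \<longlongrightarrow> 0) (at_right 0)"


section \<open>Generalized differential quotients in normed spaces\<close>

text \<open>For non-empty \<open>\<Lambda>\<close>, \<open>infdist A \<Lambda>\<close> is the infimum of \<open>dist A L\<close> over \<open>L \<in> \<Lambda>\<close>, and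
  \<open>dist\<close> on \<open>'a \<Rightarrow>\<^sub>L 'b\<close> is that of the operator norm.\<close>

definition GDQ ::
  "('a::real_normed_vector \<Rightarrow> 'b::real_normed_vector set) \<Rightarrow> 'a \<Rightarrow> 'b \<Rightarrow> 'a set \<Rightarrow>
     ('a \<Rightarrow>\<^sub>L 'b) set \<Rightarrow> bool" where
  "GDQ F xs ys S \<Lambda> \<longleftrightarrow>
     ys \<in> F xs \<and> compact \<Lambda> \<and> \<Lambda> \<noteq> {} \<and> S \<noteq> {} \<and>
     (\<forall>\<delta>>0. \<exists>U G.
        compact U \<and> 0 \<in> interior U \<and> compact ((\<lambda>u. xs + u) ` U \<inter> S) \<and>
        CCA ((\<lambda>u. xs + u) ` U \<inter> S) {A. infdist A \<Lambda> \<le> \<delta>} G \<and>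
        (\<forall>x \<in> (\<lambda>u. xs + u) ` U \<inter> S. \<forall>L \<in> G x. ys + blinfun_apply L (x - xs) \<in> F x))"


section \<open>Manifolds of class \<open>C\<^sup>1\<close>\<close>

text \<open>A chart is a pair of a domain and a map; values of the map off the domain are irrelevant.\<close>

type_synonym ('a, 'e) chart = "'a set \<times> ('a \<Rightarrow> 'e)"

definition chart_inv :: "('a, 'e) chart \<Rightarrow> 'e \<Rightarrow> 'a" where
  "chart_inv c = inv_into (fst c) (snd c)"

definition is_chart :: "('a::topological_space, 'e::topological_space) chart \<Rightarrow> bool" where
  "is_chart c \<longleftrightarrow> open (fst c) \<and> open (snd c ` fst c) \<and>
     homeomorphism (fst c) (snd c ` fst c) (snd c) (chart_inv c)"

definition C1_on ::
  "'e::real_normed_vector set \<Rightarrow> ('e \<Rightarrow> 'f::real_normed_vector) \<Rightarrow> bool" where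
  "C1_on W f \<longleftrightarrow> (\<exists>f'. continuous_on W f' \<and>
     (\<forall>x\<in>W. (f has_derivative blinfun_apply (f' x)) (at x)))"

definition C1_compatible ::
  "('a, 'e::real_normed_vector) chart \<Rightarrow> ('a, 'e) chart \<Rightarrow> bool" where
  "C1_compatible c c' \<longleftrightarrow>
     C1_on (snd c ` (fst c \<inter> fst c')) (snd c' \<circ> chart_inv c) \<and>
     C1_on (snd c' ` (fst c \<inter> fst c')) (snd c \<circ> chart_inv c')"

text \<open>A \<open>C\<^sup>1\<close> structure (maximal atlas) on the space \<open>'a\<close>, modelled on a Euclidean space
  \<open>'e\<close>, i.e. a finite-dimensional real inner product space. The class \<open>euclidean_space\<close> is
  not used for \<open>'e\<close> because it excludes dimension 0.\<close>

definition C1_manifold ::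
  "('a::topological_space, 'e::real_inner) chart set \<Rightarrow> bool" where
  "C1_manifold A \<longleftrightarrow>
     (\<exists>B::'e set. finite B \<and> span B = UNIV) \<and>
     (\<forall>c\<in>A. is_chart c) \<and> (\<Union>c\<in>A. fst c) = UNIV \<and>
     (\<forall>c\<in>A. \<forall>c'\<in>A. C1_compatible c c') \<and>
     (\<forall>c. is_chart c \<and> (\<forall>c'\<in>A. C1_compatible c c') \<longrightarrow> c \<in> A)"

text \<open>The standard \<open>C\<^sup>1\<close> structure of a normed space.\<close>

definition standard_charts :: "('f::real_normed_vector, 'f) chart set" where
  "standard_charts = {c. is_chart c \<and> C1_compatible c (UNIV, id)}"


section \<open>Tangent spaces\<close>

text \<open>A tangent vector at \<open>p\<close> is the family of its components in all charts at \<open>p\<close>,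
  transforming by the derivatives of the coordinate changes (and 0 for all other pairs, so that
  equality of functions is equality of tangent vectors). The vector space operations are the
  pointwise ones.\<close>

type_synonym ('a, 'e) tvec = "('a, 'e) chart \<Rightarrow> 'e"

definition tangent_space ::
  "('a, 'e::real_normed_vector) chart set \<Rightarrow> 'a \<Rightarrow> ('a, 'e) tvec set" where
  "tangent_space A p = {\<xi>.
     (\<forall>c\<in>A. \<forall>c'\<in>A. p \<in> fst c \<and> p \<in> fst c' \<longrightarrow>
        \<xi> c' = frechet_derivative (snd c' \<circ> chart_inv c) (at (snd c p)) (\<xi> c)) \<and>
     (\<forall>c. \<not> (c \<in> A \<and> p \<in> fst c) \<longrightarrow> \<xi> c = 0)}"

text \<open>The differential at \<open>p\<close> of the chart \<open>c\<close> is the isomorphism \<open>\<lambda>\<xi>. \<xi> c\<close> of the tangent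
  space onto \<open>'e\<close>; the following is its inverse.\<close>

definition dchart_inv ::
  "('a, 'e::real_normed_vector) chart set \<Rightarrow> 'a \<Rightarrow> ('a, 'e) chart \<Rightarrow> 'e \<Rightarrow> ('a, 'e) tvec" where
  "dchart_inv A p c = inv_into (tangent_space A p) (\<lambda>\<xi>. \<xi> c)"

definition Lin_tangent ::
  "('a, 'e::real_normed_vector) chart set \<Rightarrow> 'a \<Rightarrow>
     (('a, 'e) tvec \<Rightarrow> 'f::real_normed_vector) set" where
  "Lin_tangent A p = {L \<in> extensional (tangent_space A p).
     \<forall>\<xi>\<in>tangent_space A p. \<forall>\<eta>\<in>tangent_space A p. \<forall>a b.
       L (\<lambda>c. a *\<^sub>R \<xi> c + b *\<^sub>R \<eta> c) = a *\<^sub>R L \<xi> + b *\<^sub>R L \<eta>}"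

text \<open>The linear map \<open>L\<close> composed with the inverse of the differential of \<open>c\<close> at \<open>p\<close>.
  For each chart \<open>c\<close> at \<open>p\<close> this identifies \<open>Lin_tangent A p\<close> linearly with
  \<open>'e \<Rightarrow>\<^sub>L 'f\<close>, and it is through this identification that \<open>Lin_tangent A p\<close> is
  topologized; in finite dimension neither the topology nor convexity depends on \<open>c\<close>.\<close>

definition lin_coord ::
  "('a, 'e::real_normed_vector) chart set \<Rightarrow> 'a \<Rightarrow> ('a, 'e) chart \<Rightarrow>
     (('a, 'e) tvec \<Rightarrow> 'f::real_normed_vector) \<Rightarrow> ('e \<Rightarrow>\<^sub>L 'f)" where
  "lin_coord A p c L = Blinfun (\<lambda>v. L (dchart_inv A p c v))"


section \<open>Riemannian distances\<close>

text \<open>On a \<open>C\<^sup>1\<close> manifold the natural regularity of a Riemannian metric is continuity.\<close>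

definition riemannian_metric_on ::
  "('a::topological_space, 'e::real_normed_vector) chart set \<Rightarrow> 'a set \<Rightarrow>
     ('a \<Rightarrow> ('a, 'e) tvec \<Rightarrow> ('a, 'e) tvec \<Rightarrow> real) \<Rightarrow> bool" where
  "riemannian_metric_on A W g \<longleftrightarrow>
     (\<forall>p\<in>W. \<forall>\<xi>\<in>tangent_space A p. \<forall>\<eta>\<in>tangent_space A p. \<forall>\<zeta>\<in>tangent_space A p.
        g p \<xi> \<eta> = g p \<eta> \<xi> \<and>
        (\<forall>a b. g p (\<lambda>c. a *\<^sub>R \<xi> c + b *\<^sub>R \<eta> c) \<zeta> = a * g p \<xi> \<zeta> + b * g p \<eta> \<zeta>) \<and>
        (\<xi> \<noteq> (\<lambda>c. 0) \<longrightarrow> g p \<xi> \<xi> > 0)) \<and>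
     (\<forall>c\<in>A. continuous_on ((W \<inter> fst c) \<times> UNIV \<times> UNIV)
        (\<lambda>(p, u, v). g p (dchart_inv A p c u) (dchart_inv A p c v)))"

definition C1_curve_in ::
  "('a::topological_space, 'e::real_normed_vector) chart set \<Rightarrow> 'a set \<Rightarrow> (real \<Rightarrow> 'a) \<Rightarrow> bool" where
  "C1_curve_in A W \<gamma> \<longleftrightarrow> continuous_on {0..1} \<gamma> \<and> \<gamma> ` {0..1} \<subseteq> W \<and>
     (\<forall>c\<in>A. \<exists>D. continuous_on {t\<in>{0..1}. \<gamma> t \<in> fst c} D \<and>
        (\<forall>t\<in>{0..1}. \<gamma> t \<in> fst c \<longrightarrow>
           ((snd c \<circ> \<gamma>) has_vector_derivative D t) (at t within {0..1})))"

definition velocity ::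
  "('a, 'e::real_normed_vector) chart set \<Rightarrow> (real \<Rightarrow> 'a) \<Rightarrow> real \<Rightarrow> ('a, 'e) tvec" where
  "velocity A \<gamma> t = (\<lambda>c. if c \<in> A \<and> \<gamma> t \<in> fst c
     then vector_derivative (snd c \<circ> \<gamma>) (at t within {0..1}) else 0)"

definition curve_length ::
  "('a, 'e::real_normed_vector) chart set \<Rightarrow>
     ('a \<Rightarrow> ('a, 'e) tvec \<Rightarrow> ('a, 'e) tvec \<Rightarrow> real) \<Rightarrow> (real \<Rightarrow> 'a) \<Rightarrow> real" where
  "curve_length A g \<gamma> =
     integral {0..1} (\<lambda>t. sqrt (g (\<gamma> t) (velocity A \<gamma> t) (velocity A \<gamma> t)))"

text \<open>The metric lives on an open set \<open>W\<close> containing \<open>V\<close>: \<open>W = V\<close> gives the intrinsic distance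
  of an open \<open>V\<close>, \<open>W = UNIV\<close> the restriction of a Riemannian distance of the manifold.
  A piecewise \<open>C\<^sup>1\<close> curve can be reparametrized, with vanishing velocity at its corners, to
  a \<open>C\<^sup>1\<close> curve of equal length, so it is enough to take the infimum over \<open>C\<^sup>1\<close> curves.
  The connecting curves required to exist make the distance finite.\<close>

definition riemannian_distance_on ::
  "('a::topological_space, 'e::real_normed_vector) chart set \<Rightarrow> 'a set \<Rightarrow>
     ('a \<Rightarrow> 'a \<Rightarrow> real) \<Rightarrow> bool" where
  "riemannian_distance_on A V d \<longleftrightarrow>
     (\<exists>W g. open W \<and> V \<subseteq> W \<and> riemannian_metric_on A W g \<and>
        (\<forall>x\<in>V. \<forall>y\<in>V. (\<exists>\<gamma>. C1_curve_in A W \<gamma> \<and> \<gamma> 0 = x \<and> \<gamma> 1 = y) \<and>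
           d x y = Inf {curve_length A g \<gamma> | \<gamma>. C1_curve_in A W \<gamma> \<and> \<gamma> 0 = x \<and> \<gamma> 1 = y}))"


section \<open>Generalized differential quotients on manifolds\<close>

text \<open>The representation \<open>\<psi> \<circ> F \<circ> \<phi>\<^sup>-\<^sup>1\<close> of \<open>F\<close> in charts \<open>c = (U, \<phi>)\<close>, \<open>k = (V', \<psi>)\<close>, with
  empty values off \<open>\<phi>(U)\<close> and with the values of \<open>F\<close> off \<open>V'\<close> discarded.\<close>

definition chart_rep ::
  "('a, 'e) chart \<Rightarrow> ('f, 'f) chart \<Rightarrow> ('a \<Rightarrow> 'f set) \<Rightarrow> 'e \<Rightarrow> 'f set" where
  "chart_rep c k F v =
     (if v \<in> snd c ` fst c then snd k ` (F (chart_inv c v) \<inter> fst k) else {})"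

text \<open>The target manifold is the normed space \<open>'f\<close> with its standard structure, whose tangent
  spaces are \<open>'f\<close>. The notion does not depend on the centered charts; the definition asks for
  the property in all of them.\<close>

definition manifold_GDQ ::
  "('a::topological_space, 'e::real_normed_vector) chart set \<Rightarrow>
     ('a \<Rightarrow> 'f::real_normed_vector set) \<Rightarrow> 'a \<Rightarrow> 'f \<Rightarrow> 'a set \<Rightarrow>
     (('a, 'e) tvec \<Rightarrow> 'f) set \<Rightarrow> bool" where
  "manifold_GDQ A F xs ys S \<Lambda> \<longleftrightarrow>
     ys \<in> F xs \<and> \<Lambda> \<subseteq> Lin_tangent A xs \<and>
     (\<forall>c\<in>A. \<forall>k\<in>standard_charts.
        xs \<in> fst c \<and> snd c xs = 0 \<and> ys \<in> fst k \<and> snd k ys = 0 \<longrightarrow>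
        GDQ (chart_rep c k F) 0 0 (snd c ` (fst c \<inter> S))
          ((\<lambda>L. Blinfun (frechet_derivative (snd k) (at ys)) o\<^sub>L lin_coord A xs c L) ` \<Lambda>))"

end

theory Submission
  imports Defs
begin

text \<open>
  Work in two coordinate systems: the chart \<open>\<kappa>\<close> of the hypotheses, in which convexity of the values
  \<open>Fs j x\<close> is available, and an arbitrary pair of centered charts \<open>c\<close>, \<open>k\<close>, in which the
  conclusion has to be checked. Let \<open>h v\<close> be the \<open>\<kappa>\<close>-displacement from \<open>xs\<close> of the point \<open>x\<close> with
  \<open>c\<close>-coordinate \<open>v\<close>, let \<open>\<Lambda>\<^sub>\<kappa>\<close> be \<open>\<Lambda>\<close> in the coordinates \<open>\<kappa>\<close>, and let \<open>Y\<close> be the closed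
  neighbourhood of \<open>\<Lambda>\<^sub>\<kappa>\<close> of small radius \<open>\<delta>\<^sub>1\<close>. The candidate is the set \<open>G v\<close> of all \<open>L \<in> Y\<close> with
  \<open>ys + L (h v) \<in> F x\<close>, and \<open>H v\<close> denotes the corresponding set for \<open>Fs j\<close>.

  \<^item> \<open>H v\<close> is convex because \<open>Y\<close> and \<open>Fs j x\<close> are, and its graph over a compact set is compact
    because graphs of closed-valued upper semi-continuous maps are closed
    (\<open>closedin_graph_of_usc\<close>, \<open>compact_graph_pullback\<close>).
  \<^item> \<open>H v\<close> is non-empty for large \<open>j\<close> and small \<open>v\<close>. The growth condition gives \<open>y \<in> Fs j x\<close> and
    \<open>L \<in> \<Lambda>\<^sub>\<kappa>\<close> whose error \<open>y - ys - L (h v)\<close> is at most \<open>d x xs * \<omega> j (d x xs)\<close>; since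
    \<open>d x xs \<le> C * norm (h v)\<close> (\<open>riemannian_distance_le_coordinate_distance\<close>) and \<open>\<omega> j\<close> is uniformly
    small near 0, a rank one correction of \<open>L\<close> of norm at most \<open>\<delta>\<^sub>1\<close> removes the error
    (\<open>linear_map_through_point\<close>).
  \<^item> Inward graph convergence pulls back along \<open>(v, L) \<mapsto> (x, ys + L (h v))\<close>: the complement of a
    neighbourhood of the graph of \<open>G\<close> is compact and its image misses the graph of \<open>F\<close>, hence that of
    \<open>Fs j\<close> for large \<open>j\<close> (\<open>inward_graph_converges_pullback\<close>). So the graph of \<open>H\<close> lies in any
    prescribed neighbourhood of that of \<open>G\<close>, and by Cellina's theorem (\<open>cellina_approximation\<close>)
    that neighbourhood contains the graph of a continuous map. Thus \<open>G\<close> is CCA.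

  It remains to pass to the charts \<open>c\<close>, \<open>k\<close>, where a nonlinear coordinate change would destroy
  convexity. This is done after the approximation, by composing with a continuous map
  \<open>P (v, L)\<close> that turns \<open>L\<close> into a linear map sending \<open>v\<close> exactly to the \<open>k\<close>-coordinate of
  \<open>ys + L (h v)\<close>: it is \<open>M \<circ> L \<circ> N\<close>, with \<open>M\<close> and \<open>N\<close> the derivatives of \<open>k\<close> and \<open>h\<close>, plus a rank one
  correction, which tends to 0 as \<open>v \<rightarrow> 0\<close> by differentiability alone (\<open>continuous_on_secant_map\<close>).
  The CCA property survives such a composition (\<open>CCA_image\<close>).
\<close>

section \<open>Bounded linear maps on finite-dimensional inner product spaces\<close>

text \<open>One step of Gram-Schmidt per element. The general spanning set formulation covers dimension
  0, which the class of Euclidean spaces excludes.\<close>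

lemma orthonormal_spanning_set:
  fixes B :: "'e::real_inner set"
  assumes "finite B"
  shows "\<exists>C. finite C \<and> (\<forall>c\<in>C. \<forall>c'\<in>C. c \<bullet> c' = (if c = c' then 1 else 0)) \<and> B \<subseteq> span C"
  using assms
proof (induction B)
  case empty
  show ?case by (rule exI[of _ "{}"]) auto
next
  case (insert b B)
  then obtain C where C: "finite C" "\<And>c c'. c \<in> C \<Longrightarrow> c' \<in> C \<Longrightarrow> c \<bullet> c' = (if c = c' then 1 else 0)"
    "B \<subseteq> span C" by auto
  define b' where "b' = b - (\<Sum>c\<in>C. (b \<bullet> c) *\<^sub>R c)"
  have sC: "(\<Sum>c\<in>C. (b \<bullet> c) *\<^sub>R c) \<in> span C"
    by (intro span_sum span_scale span_base)
  have orth: "b' \<bullet> a = 0" if a: "a \<in> C" for a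
  proof -
    have "(\<Sum>c\<in>C. (b \<bullet> c) *\<^sub>R c) \<bullet> a = (\<Sum>c\<in>C. if c = a then b \<bullet> c else 0)"
      unfolding inner_sum_left by (rule sum.cong) (auto simp: C(2) a)
    also have "\<dots> = b \<bullet> a" using a C(1) by simp
    finally show ?thesis by (simp add: b'_def inner_diff_left)
  qed
  show ?case
  proof (cases "b' = 0")
    case True
    then have "b \<in> span C" using sC by (simp add: b'_def)
    with C show ?thesis by (intro exI[of _ C]) auto
  next
    case False
    define u where "u = b' /\<^sub>R norm b'"
    have u1: "u \<bullet> u = 1" using False
      by (simp add: u_def dot_square_norm power2_eq_square)
    have u0: "u \<bullet> a = 0" "a \<bullet> u = 0" if "a \<in> C" for a
      using orth[OF that] by (auto simp: u_def inner_commute)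
    have "b = norm b' *\<^sub>R u + (\<Sum>c\<in>C. (b \<bullet> c) *\<^sub>R c)" using False by (simp add: u_def b'_def)
    moreover have "\<dots> \<in> span (insert u C)"
      using span_mono[of C "insert u C"] sC by (intro span_add span_scale[OF span_base]) auto
    ultimately have "b \<in> span (insert u C)" by simp
    moreover have "u \<notin> C" using u0(1)[of u] u1 by fastforce
    ultimately have "\<forall>c\<in>insert u C. \<forall>c'\<in>insert u C. c \<bullet> c' = (if c = c' then 1 else 0)"
      using C(2) u1 u0 by (metis insert_iff)
    moreover have "insert b B \<subseteq> span (insert u C)"
      using C(3) span_mono[of C "insert u C"] \<open>b \<in> span (insert u C)\<close> by blast
    ultimately show ?thesis using C(1) by blast
  qed
qed

lemma orthonormal_basis_expansion:
  assumes "\<exists>B::'e::real_inner set. finite B \<and> span B = UNIV"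
  shows "\<exists>C::'e set. finite C \<and> (\<forall>c\<in>C. norm c = 1) \<and> (\<forall>x. (\<Sum>c\<in>C. (x \<bullet> c) *\<^sub>R c) = x)"
proof -
  obtain B :: "'e set" where B: "finite B" "span B = UNIV" using assms by auto
  obtain C :: "'e set" where C: "finite C"
    "\<And>c c'. c \<in> C \<Longrightarrow> c' \<in> C \<Longrightarrow> c \<bullet> c' = (if c = c' then 1 else 0)" "B \<subseteq> span C"
    using orthonormal_spanning_set[OF B(1)] by auto
  have "span C = UNIV" using B(2) C(3) span_minimal[of B "span C"] by auto
  then have "(\<Sum>c\<in>C. (x \<bullet> c) *\<^sub>R c) = x" for x
  proof -
    assume "span C = UNIV"
    then have "x \<in> span C" by simp
    then obtain f where f: "x = (\<Sum>c\<in>C. f c *\<^sub>R c)" unfolding span_finite[OF C(1)] by auto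
    have "x \<bullet> a = f a" if a: "a \<in> C" for a
    proof -
      have "x \<bullet> a = (\<Sum>c\<in>C. if c = a then f c else 0)"
        unfolding f inner_sum_left by (rule sum.cong) (auto simp: C(2) a)
      then show ?thesis using a C(1) by simp
    qed
    then show ?thesis using f by simp
  qed
  moreover have "norm c = 1" if "c \<in> C" for c using C(2)[OF that that] by (simp add: norm_eq_1)
  ultimately show ?thesis using C(1) by blast
qed

lemma compact_closed_subset:
  assumes "compact S" "closed T" "T \<subseteq> S"
  shows "compact T"
  using compact_Int_closed[OF assms(1,2)] assms(3) by (simp add: inf.absorb2)

text \<open>The compactness of bounded coefficient sets, from which closed balls of finite-dimensional
  spaces are seen to be compact.\<close>

lemma compact_sum_image:
  fixes f :: "'i \<Rightarrow> 'b::metric_space \<Rightarrow> 'c::real_normed_vector"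
  assumes "finite C" "compact K" "\<And>c. c \<in> C \<Longrightarrow> continuous_on K (f c)"
  shows "compact {(\<Sum>c\<in>C. f c (w c)) | w. \<forall>c\<in>C. w c \<in> K}"
  using assms(1,3)
proof (induction C)
  case empty
  show ?case by simp
next
  case (insert a C)
  have "compact {x + y | x y. x \<in> f a ` K \<and> y \<in> {(\<Sum>c\<in>C. f c (w c)) | w. \<forall>c\<in>C. w c \<in> K}}"
    using insert assms(2) by (intro compact_sums compact_continuous_image) auto
  also have "{x + y | x y. x \<in> f a ` K \<and> y \<in> {(\<Sum>c\<in>C. f c (w c)) | w. \<forall>c\<in>C. w c \<in> K}} =
    {(\<Sum>c\<in>insert a C. f c (w c)) | w. \<forall>c\<in>insert a C. w c \<in> K}" (is "?L = ?R")
  proof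
    show "?L \<subseteq> ?R"
    proof
      fix z assume "z \<in> ?L"
      then obtain k w where kw: "k \<in> K" "\<forall>c\<in>C. w c \<in> K" "z = f a k + (\<Sum>c\<in>C. f c (w c))" by auto
      have "(\<Sum>c\<in>C. f c (w c)) = (\<Sum>c\<in>C. f c ((w(a := k)) c))"
        using insert by (intro sum.cong) auto
      then show "z \<in> ?R" using kw insert by (intro CollectI exI[of _ "w(a := k)"]) auto
    qed
    show "?R \<subseteq> ?L" using insert by auto
  qed
  finally show ?case .
qed

definition rank_one :: "'f::real_normed_vector \<Rightarrow> 'e::real_inner \<Rightarrow> 'e \<Rightarrow>\<^sub>L 'f" where
  "rank_one w u = blinfun_scaleR_left w o\<^sub>L blinfun_inner_right u"

lemma rank_one_apply: "blinfun_apply (rank_one w u) x = (u \<bullet> x) *\<^sub>R w"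
  by (simp add: rank_one_def)

lemma norm_rank_one_le: "norm (rank_one w u) \<le> norm w * norm u"
proof (rule norm_blinfun_bound)
  show "norm (blinfun_apply (rank_one w u) x) \<le> norm w * norm u * norm x" for x
    using mult_right_mono[OF Cauchy_Schwarz_ineq2[of u x] norm_ge_zero[of w]]
    by (simp add: rank_one_apply mult_ac)
qed simp

lemma bounded_bilinear_rank_one: "bounded_bilinear rank_one"
proof
  show "\<exists>K. \<forall>a b. norm (rank_one a b) \<le> norm a * norm b * K"
    using norm_rank_one_le by (intro exI[of _ 1]) auto
qed (auto intro!: blinfun_eqI simp: rank_one_apply blinfun.add_left blinfun.scaleR_left
       scaleR_add_right inner_add_left scaleR_add_left)

lemmas tendsto_rank_one = bounded_bilinear.tendsto[OF bounded_bilinear_rank_one]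
  and continuous_on_rank_one = bounded_bilinear.continuous_on[OF bounded_bilinear_rank_one]

text \<open>The rank one map with image spanned by \<open>e\<close> that takes \<open>v\<close> to \<open>e\<close>. As \<open>inverse 0 = 0\<close>, the
  same formula serves for \<open>v = 0\<close>, where only \<open>e = 0\<close> can be reached.\<close>

lemma rank_one_correction:
  assumes "v = 0 \<Longrightarrow> e = 0"
  shows "blinfun_apply (rank_one e (v /\<^sub>R (norm v)\<^sup>2)) v = e"
  using assms by (cases "v = 0") (auto simp: rank_one_apply dot_square_norm)

text \<open>Prescribing the value at \<open>v\<close> costs no more, in operator norm, than the relative error that
  is to be corrected.\<close>

lemma norm_rank_one_correction_le:
  assumes "norm e \<le> b * norm v" "0 \<le> b"
  shows "norm (rank_one e (v /\<^sub>R (norm v)\<^sup>2)) \<le> b"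
proof -
  have "norm (rank_one e (v /\<^sub>R (norm v)\<^sup>2)) \<le> norm e * (norm v / (norm v)\<^sup>2)"
    using norm_rank_one_le[of e "v /\<^sub>R (norm v)\<^sup>2"] by (simp add: divide_inverse mult_ac)
  also have "\<dots> \<le> b"
    using assms by (cases "v = 0") (auto simp: power2_eq_square divide_le_eq)
  finally show ?thesis .
qed

lemma compact_cball_finite_dim:
  assumes fin: "\<exists>B::'e::real_inner set. finite B \<and> span B = UNIV"
  shows "compact (cball (0::'e::real_inner) R)"
proof -
  from orthonormal_basis_expansion[OF fin] obtain C :: "'e set" where "finite C"
    and C': "\<forall>c\<in>C. norm c = 1" "\<forall>x. (\<Sum>c\<in>C. (x \<bullet> c) *\<^sub>R c) = x" by (elim exE conjE)
  note C = \<open>finite C\<close> bspec[OF C'(1)] spec[OF C'(2)]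
  have "compact {(\<Sum>c\<in>C. w c *\<^sub>R c) | w. \<forall>c\<in>C. w c \<in> cball (0::real) R}"
    by (intro compact_sum_image C continuous_intros) auto
  moreover have "cball 0 R \<subseteq> {(\<Sum>c\<in>C. w c *\<^sub>R c) | w. \<forall>c\<in>C. w c \<in> cball (0::real) R}"
  proof
    fix x :: 'e assume x: "x \<in> cball 0 R"
    have "\<bar>x \<bullet> c\<bar> \<le> R" if "c \<in> C" for c
      using Cauchy_Schwarz_ineq2[of x c] C(2)[OF that] x by simp
    then have "\<forall>c\<in>C. x \<bullet> c \<in> cball 0 R" by simp
    then show "x \<in> {(\<Sum>c\<in>C. w c *\<^sub>R c) | w. \<forall>c\<in>C. w c \<in> cball (0::real) R}"
      using C(3)[of x, symmetric] by (intro CollectI exI[of _ "\<lambda>c. x \<bullet> c"] conjI)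
  qed
  ultimately show ?thesis
    by (rule compact_closed_subset[OF _ closed_cball])
qed

text \<open>A bounded map is the sum, over an orthonormal basis, of the rank one maps given by its
  values on the basis; these values range over a compact ball.\<close>

lemma compact_cball_blinfun_finite_dim:
  assumes fin: "\<exists>B::'e::real_inner set. finite B \<and> span B = UNIV"
  shows "compact (cball (0::'e::real_inner \<Rightarrow>\<^sub>L 'f::euclidean_space) R)"
proof -
  from orthonormal_basis_expansion[OF fin] obtain C :: "'e set" where "finite C"
    and C': "\<forall>c\<in>C. norm c = 1" "\<forall>x. (\<Sum>c\<in>C. (x \<bullet> c) *\<^sub>R c) = x" by (elim exE conjE)
  note C = \<open>finite C\<close> bspec[OF C'(1)] spec[OF C'(2)]
  let ?S = "{(\<Sum>c\<in>C. rank_one (w c) c) | w. \<forall>c\<in>C. w c \<in> cball (0::'f) R}"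
  have "compact ?S"
    by (intro compact_sum_image C continuous_on_rank_one continuous_intros) auto
  moreover have "cball 0 R \<subseteq> ?S"
  proof
    fix L :: "'e \<Rightarrow>\<^sub>L 'f" assume L: "L \<in> cball 0 R"
    have "norm (blinfun_apply L c) \<le> R" if "c \<in> C" for c
      using norm_blinfun[of L c] C(2)[OF that] L by simp
    then have "\<forall>c\<in>C. blinfun_apply L c \<in> cball 0 R" by simp
    moreover have "L = (\<Sum>c\<in>C. rank_one (blinfun_apply L c) c)"
    proof (rule blinfun_eqI)
      fix x
      have "blinfun_apply L x = blinfun_apply L (\<Sum>c\<in>C. (x \<bullet> c) *\<^sub>R c)" by (simp add: C(3))
      then show "blinfun_apply L x = blinfun_apply (\<Sum>c\<in>C. rank_one (blinfun_apply L c) c) x"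
        by (simp add: blinfun.sum_right blinfun.sum_left rank_one_apply blinfun.scaleR_right inner_commute)
    qed
    ultimately show "L \<in> ?S" by (intro CollectI exI[of _ "blinfun_apply L"] conjI)
  qed
  ultimately show ?thesis
    by (rule compact_closed_subset[OF _ closed_cball])
qed

lemma linear_imp_bounded_linear_finite_dim:
  fixes f :: "'e::real_inner \<Rightarrow> 'f::real_normed_vector"
  assumes fin: "\<exists>B::'e set. finite B \<and> span B = UNIV" and f: "linear f"
  shows "bounded_linear f"
proof -
  from orthonormal_basis_expansion[OF fin] obtain C :: "'e set" where "finite C"
    and C': "\<forall>c\<in>C. norm c = 1" "\<forall>x. (\<Sum>c\<in>C. (x \<bullet> c) *\<^sub>R c) = x" by (elim exE conjE)
  note C = \<open>finite C\<close> bspec[OF C'(1)] spec[OF C'(2)]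
  have "f = blinfun_apply (\<Sum>c\<in>C. rank_one (f c) c)"
  proof
    fix x
    have "f x = f (\<Sum>c\<in>C. (x \<bullet> c) *\<^sub>R c)" by (simp add: C(3))
    then show "f x = blinfun_apply (\<Sum>c\<in>C. rank_one (f c) c) x"
      by (simp add: linear_sum[OF f] blinfun.sum_left rank_one_apply linear_scale[OF f] inner_commute)
  qed
  then show ?thesis using blinfun.bounded_linear_right by metis
qed

section \<open>Graphs of set-valued maps\<close>

text \<open>A point off the graph is separated from the closed value by a closed ball, whose complement
  is a neighbourhood of that value to which upper semi-continuity applies.\<close>

lemma closedin_graph_of_usc:
  fixes F :: "'a::topological_space \<Rightarrow> 'b::metric_space set"
  assumes usc: "usc_on X F" and cl: "\<And>x. x \<in> X \<Longrightarrow> closed (F x)"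
  shows "closedin (top_of_set (X \<times> UNIV)) (gr X F)"
proof -
  have "openin (top_of_set (X \<times> UNIV)) (X \<times> UNIV - gr X F)"
  proof (subst openin_subopen, intro ballI)
    fix p assume "p \<in> X \<times> UNIV - gr X F"
    then obtain x y where p: "p = (x, y)" "x \<in> X" "y \<notin> F x" by (auto simp: gr_def)
    then obtain e where e: "e > 0" "cball y e \<subseteq> - F x"
      using cl[OF p(2)] open_contains_cball[of "- F x"] by auto
    then have "open (- cball y e)" "F x \<subseteq> - cball y e" by auto
    then obtain W where W: "open W" "x \<in> W" "(\<Union>z\<in>W \<inter> X. F z) \<subseteq> - cball y e"
      using usc p(2) unfolding usc_on_def by metis
    let ?T = "(X \<times> UNIV) \<inter> (W \<times> ball y e)"
    have "openin (top_of_set (X \<times> UNIV)) ?T" using W(1) by (intro openin_open_Int open_Times) auto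
    moreover have "?T \<subseteq> X \<times> UNIV - gr X F" using W(3) by (fastforce simp: gr_def)
    ultimately show "\<exists>T. openin (top_of_set (X \<times> UNIV)) T \<and> p \<in> T \<and> T \<subseteq> X \<times> UNIV - gr X F"
      using p W(2) e(1) by (intro exI[of _ ?T]) auto
  qed
  then show ?thesis by (auto simp: closedin_def gr_def)
qed

lemma usc_on_subset:
  assumes "usc_on X F" "V \<subseteq> X"
  shows "usc_on V F"
  unfolding usc_on_def
proof (intro ballI allI impI)
  fix x O2 assume "x \<in> V" "open O2 \<and> F x \<subseteq> O2"
  then obtain O1 where "open O1 \<and> x \<in> O1 \<and> (\<Union>z\<in>O1 \<inter> X. F z) \<subseteq> O2"
    using assms unfolding usc_on_def by (meson subsetD)
  then show "\<exists>O1. open O1 \<and> x \<in> O1 \<and> (\<Union>z\<in>O1 \<inter> V. F z) \<subseteq> O2"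
    using assms(2) by (intro exI[of _ O1]) auto
qed

text \<open>With \<open>q\<close> the evaluation \<open>(v, L) \<mapsto> (x, ys + L (h v))\<close>, the set below is the graph of the map
  \<open>v \<mapsto> {L \<in> Y. ys + L (h v) \<in> F x}\<close>.\<close>

lemma compact_graph_pullback:
  assumes K: "compact K" "compact Y" and q: "continuous_on (K \<times> Y) q" "q ` (K \<times> Y) \<subseteq> V \<times> UNIV"
    and cl: "closedin (top_of_set (V \<times> UNIV)) (gr V F)"
  shows "compact {p \<in> K \<times> Y. q p \<in> gr V F}"
proof -
  have "closedin (top_of_set (K \<times> Y)) (K \<times> Y \<inter> q -` gr V F)"
    using continuous_closedin_preimage_gen[OF q(1) _ cl] q(2) by blast
  then have "compact (K \<times> Y \<inter> q -` gr V F)"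
    using closedin_compact[OF compact_Times[OF K]] by blast
  moreover have "K \<times> Y \<inter> q -` gr V F = {p \<in> K \<times> Y. q p \<in> gr V F}" by blast
  ultimately show ?thesis by simp
qed

text \<open>The part of \<open>K \<times> Y\<close> outside \<open>\<Omega>\<close> is compact, so its image under \<open>q\<close> is closed, and it misses
  the graph of \<open>F\<close>; the complement of this image is an admissible neighbourhood in the definition
  of convergence.\<close>

lemma inward_graph_converges_pullback:
  fixes F :: "'a::t2_space \<Rightarrow> 'b::t2_space set"
  assumes conv: "inward_graph_converges V UNIV Fs F" and ne: "gr V F \<noteq> {}"
    and K: "compact K" "compact Y" and q: "continuous_on (K \<times> Y) q"
    and \<Omega>: "openin (top_of_set (K \<times> Y)) \<Omega>" "{p \<in> K \<times> Y. q p \<in> gr V F} \<subseteq> \<Omega>"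
  shows "\<exists>J. \<forall>j\<ge>J. {p \<in> K \<times> Y. q p \<in> gr V (Fs j)} \<subseteq> \<Omega>"
proof -
  let ?D = "q ` (K \<times> Y - \<Omega>)"
  obtain T where T: "open T" "\<Omega> = K \<times> Y \<inter> T" using \<Omega>(1) unfolding openin_open by blast
  have eq: "K \<times> Y - \<Omega> = K \<times> Y \<inter> - T" unfolding T(2) by blast
  have "compact (K \<times> Y - \<Omega>)"
    unfolding eq by (rule compact_Int_closed[OF compact_Times[OF K] closed_Compl[OF T(1)]])
  then have "compact ?D"
    by (rule compact_continuous_image[OF continuous_on_subset[OF q Diff_subset]])
  then have "open (- ?D)" using compact_imp_closed by blast
  then have "openin (top_of_set (V \<times> UNIV)) ((V \<times> UNIV) \<inter> - ?D)"
    by (rule openin_open_Int)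
  moreover have sub: "gr V F \<subseteq> (V \<times> UNIV) \<inter> - ?D"
  proof
    fix p assume p: "p \<in> gr V F"
    then have "p \<notin> ?D" using \<Omega>(2) by blast
    with p show "p \<in> (V \<times> UNIV) \<inter> - ?D" by (auto simp: gr_def)
  qed
  moreover have "(V \<times> UNIV) \<inter> - ?D \<noteq> {}" using sub ne by blast
  ultimately have "\<exists>J. \<forall>j\<ge>J. gr V (Fs j) \<subseteq> (V \<times> UNIV) \<inter> - ?D"
    using conv[unfolded inward_graph_converges_def, rule_format, of "(V \<times> UNIV) \<inter> - ?D"] by simp
  then obtain J where J: "\<forall>j\<ge>J. gr V (Fs j) \<subseteq> (V \<times> UNIV) \<inter> - ?D" ..
  have "{p \<in> K \<times> Y. q p \<in> gr V (Fs j)} \<subseteq> \<Omega>" if "j \<ge> J" for j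
  proof (rule subsetI, rule ccontr)
    fix p assume "p \<in> {p \<in> K \<times> Y. q p \<in> gr V (Fs j)}" "p \<notin> \<Omega>"
    then have "q p \<in> ?D" "q p \<in> gr V (Fs j)" by auto
    then show False using J that by blast
  qed
  then show ?thesis by blast
qed

section \<open>Cellina's approximation theorem\<close>

text \<open>Upper semi-continuity with a radius \<open>\<eta>\<close> uniform in the base point, at the price of comparing
  with the value at a nearby point \<open>x\<close> instead of \<open>z\<close>. If no \<open>\<eta>\<close> worked, points \<open>z n\<close> violating it
  would accumulate at some \<open>l\<close>; taking \<open>x = l\<close>, the offending values would accumulate, by
  compactness of the graph, at an element of \<open>G l\<close>.\<close>

lemma compact_graph_uniformly_usc:
  fixes G :: "'a::metric_space \<Rightarrow> 'b::metric_space set"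
  assumes K: "compact K" and gr: "compact (gr K G)" and "\<epsilon> > 0"
  shows "\<exists>\<eta>>0. \<forall>z\<in>K. \<exists>x\<in>K. dist z x < \<epsilon> \<and>
           (\<forall>z'\<in>K. dist z' z < \<eta> \<longrightarrow> (\<forall>L\<in>G z'. \<exists>L'\<in>G x. dist L L' < \<epsilon>))"
proof (rule ccontr)
  assume neg: "\<not> ?thesis"
  have "\<exists>z\<in>K. \<forall>x\<in>K. dist z x < \<epsilon> \<longrightarrow>
      (\<exists>z'\<in>K. dist z' z < inverse (Suc n) \<and> (\<exists>L\<in>G z'. \<forall>L'\<in>G x. \<epsilon> \<le> dist L L'))" for n
  proof -
    have "inverse (real (Suc n)) > 0" by simp
    then have "\<not> (\<forall>z\<in>K. \<exists>x\<in>K. dist z x < \<epsilon> \<and> (\<forall>z'\<in>K. dist z' z < inverse (real (Suc n)) \<longrightarrow>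
        (\<forall>L\<in>G z'. \<exists>L'\<in>G x. dist L L' < \<epsilon>)))"
      using neg by blast
    then show ?thesis by (simp add: not_less not_le imp_conv_disj)
  qed
  then obtain z where zK: "\<And>n. z n \<in> K"
    and z: "\<And>n x. x \<in> K \<Longrightarrow> dist (z n) x < \<epsilon> \<Longrightarrow>
      \<exists>z'\<in>K. dist z' (z n) < inverse (Suc n) \<and> (\<exists>L\<in>G z'. \<forall>L'\<in>G x. \<epsilon> \<le> dist L L')"
    by metis
  obtain l r where l: "l \<in> K" "strict_mono r" "(z \<circ> r) \<longlonglongrightarrow> l"
    using K zK unfolding compact_def by meson
  have "\<forall>\<^sub>F n in sequentially. dist (z (r n)) l < \<epsilon>"
    using tendstoD[OF l(3) \<open>\<epsilon> > 0\<close>] by simp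
  then obtain N where N: "\<And>n. n \<ge> N \<Longrightarrow> dist (z (r n)) l < \<epsilon>"
    unfolding eventually_sequentially by auto
  \<comment> \<open>From the index \<open>N\<close> on, \<open>l\<close> is close enough to \<open>z (r n)\<close> to be used as the comparison point.\<close>
  define s where "s n = r (n + N)" for n
  have "\<exists>z' L. z' \<in> K \<and> L \<in> G z' \<and> dist z' (z (s n)) < inverse (Suc (s n)) \<and> (\<forall>L'\<in>G l. \<epsilon> \<le> dist L L')" for n
    using z[OF l(1) N[of "n + N"]] by (auto simp: s_def)
  then obtain z' L where z': "\<And>n. z' n \<in> K" "\<And>n. L n \<in> G (z' n)"
    "\<And>n. dist (z' n) (z (s n)) < inverse (Suc (s n))" "\<And>n L'. L' \<in> G l \<Longrightarrow> \<epsilon> \<le> dist (L n) L'"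
    by metis
  have s_mono: "strict_mono s" using l(2) by (auto simp: s_def strict_mono_def)
  have zs: "(\<lambda>n. z (s n)) \<longlonglongrightarrow> l"
    using LIMSEQ_ignore_initial_segment[OF l(3), of N] by (simp add: s_def o_def)
  have "(\<lambda>n. inverse (real (Suc (s n)))) \<longlonglongrightarrow> 0"
    using LIMSEQ_subseq_LIMSEQ[OF LIMSEQ_inverse_real_of_nat s_mono] by (simp add: o_def)
  moreover have "\<forall>n. norm (dist (z' n) (z (s n))) \<le> inverse (real (Suc (s n)))"
  proof
    show "norm (dist (z' n) (z (s n))) \<le> inverse (real (Suc (s n)))" for n
      using z'(3)[of n] by simp
  qed
  ultimately have "(\<lambda>n. dist (z' n) (z (s n))) \<longlonglongrightarrow> 0"
    by (rule Lim_null_comparison[OF always_eventually, rotated])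
  from tendsto_add[OF this tendsto_dist[OF zs tendsto_const[of l]]]
  have "(\<lambda>n. dist (z' n) (z (s n)) + dist (z (s n)) l) \<longlonglongrightarrow> 0" by simp
  moreover have "\<forall>n. norm (dist (z' n) l) \<le> dist (z' n) (z (s n)) + dist (z (s n)) l"
    by (simp add: dist_triangle)
  ultimately have "(\<lambda>n. dist (z' n) l) \<longlonglongrightarrow> 0"
    by (rule Lim_null_comparison[OF always_eventually, rotated])
  then have z'l: "z' \<longlonglongrightarrow> l" by (rule iffD2[OF tendsto_dist_iff])
  have "\<forall>n. (z' n, L n) \<in> gr K G" using z' by (simp add: gr_def)
  then obtain q t where q: "q \<in> gr K G" "strict_mono t" "((\<lambda>n. (z' n, L n)) \<circ> t) \<longlonglongrightarrow> q"
    using gr unfolding compact_def by meson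
  have "(\<lambda>n. z' (t n)) \<longlonglongrightarrow> fst q" using tendsto_fst[OF q(3)] by (simp add: o_def)
  moreover have "(\<lambda>n. z' (t n)) \<longlonglongrightarrow> l"
    using LIMSEQ_subseq_LIMSEQ[OF z'l q(2)] by (simp add: o_def)
  ultimately have "fst q = l" by (rule LIMSEQ_unique)
  then have "snd q \<in> G l" using q(1) by (auto simp: gr_def)
  moreover have "(\<lambda>n. L (t n)) \<longlonglongrightarrow> snd q" using tendsto_snd[OF q(3)] by (simp add: o_def)
  then have "\<forall>\<^sub>F n in sequentially. dist (L (t n)) (snd q) < \<epsilon>"
    using \<open>\<epsilon> > 0\<close> by (rule tendstoD)
  then obtain n where "dist (L (t n)) (snd q) < \<epsilon>" by (auto simp: eventually_sequentially)
  ultimately show False using z'(4)[of "snd q" "t n"] by simp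
qed

text \<open>Cellina's theorem. A partition of unity subordinate to balls of the radius \<open>\<eta>\<close> of
  \<open>compact_graph_uniformly_usc\<close> averages one chosen value per ball. All values that enter the
  average at \<open>z\<close> lie within \<open>\<epsilon>\<close> of one and the same convex set \<open>G x\<close>, hence so does the average.\<close>

theorem cellina_approximation:
  fixes G :: "'a::metric_space \<Rightarrow> 'b::real_normed_vector set"
  assumes K: "compact K" and gr: "compact (gr K G)" and "\<epsilon> > 0" and Y: "convex Y"
    and G: "\<And>x. x \<in> K \<Longrightarrow> G x \<noteq> {} \<and> convex (G x) \<and> G x \<subseteq> Y"
  shows "\<exists>g. continuous_on K g \<and> g ` K \<subseteq> Y \<and>
     (\<forall>z\<in>K. \<exists>x\<in>K. \<exists>L\<in>G x. dist z x < \<epsilon> \<and> dist (g z) L < \<epsilon>)"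
proof -
  obtain \<eta> where \<eta>: "\<eta> > 0" "\<And>z. z \<in> K \<Longrightarrow> \<exists>x\<in>K. dist z x < \<epsilon> \<and>
      (\<forall>z'\<in>K. dist z' z < \<eta> \<longrightarrow> (\<forall>L\<in>G z'. \<exists>L'\<in>G x. dist L L' < \<epsilon>))"
    using compact_graph_uniformly_usc[OF K gr \<open>\<epsilon> > 0\<close>] by metis
  obtain Z where Z: "finite Z" "Z \<subseteq> K" "K \<subseteq> (\<Union>c\<in>Z. ball c \<eta>)"
    using seq_compact_imp_totally_bounded[of K] K \<open>\<eta> > 0\<close> by (metis compact_eq_seq_compact_metric)
  have "\<forall>c\<in>K. \<exists>y. y \<in> G c" using G by blast
  then obtain y where y: "\<And>c. c \<in> K \<Longrightarrow> y c \<in> G c" by metis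
  \<comment> \<open>Tent functions supported on the balls; divided by their sum \<open>s\<close> they form the partition of unity.\<close>
  define \<phi> where "\<phi> c z = max 0 (\<eta> - dist c z)" for c z :: 'a
  define s where "s z = (\<Sum>c\<in>Z. \<phi> c z)" for z
  define g where "g z = (\<Sum>c\<in>Z. (\<phi> c z / s z) *\<^sub>R y c)" for z
  have \<phi>0: "\<phi> c z \<ge> 0" for c z by (simp add: \<phi>_def)
  have s0: "s z > 0" if z: "z \<in> K" for z
  proof -
    obtain c where "c \<in> Z" "dist c z < \<eta>" using subsetD[OF Z(3) z] by auto
    then show ?thesis unfolding s_def
      by (intro sum_pos2[of Z c] Z \<phi>0) (auto simp: \<phi>_def)
  qed
  \<comment> \<open>Only the centers \<open>c\<close> with \<open>dist c z < \<eta>\<close> carry weight at \<open>z\<close>.\<close>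
  have in_convex: "g z \<in> C" if z: "z \<in> K" and C: "convex C" "\<And>c. c \<in> Z \<Longrightarrow> dist c z < \<eta> \<Longrightarrow> y c \<in> C" for z C
  proof -
    let ?Z = "{c\<in>Z. dist c z < \<eta>}"
    have out: "\<phi> c z = 0" if "c \<in> Z - ?Z" for c using that by (auto simp: \<phi>_def)
    have "g z = (\<Sum>c\<in>?Z. (\<phi> c z / s z) *\<^sub>R y c)"
      unfolding g_def using Z(1) out by (intro sum.mono_neutral_right) auto
    also have "\<dots> \<in> C"
    proof (rule convex_sum)
      have "(\<Sum>c\<in>?Z. \<phi> c z) = s z"
        unfolding s_def using Z(1) out by (intro sum.mono_neutral_left) auto
      then show "(\<Sum>c\<in>?Z. \<phi> c z / s z) = 1"
        using s0[OF z] by (simp add: sum_divide_distrib[symmetric])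
    qed (use Z(1) C s0[OF z] \<phi>0 in \<open>auto intro: divide_nonneg_pos\<close>)
    finally show ?thesis .
  qed
  have "continuous_on K g" unfolding g_def s_def \<phi>_def
    by (intro continuous_intros) (use s0 in \<open>force simp: s_def \<phi>_def\<close>)
  moreover have "g ` K \<subseteq> Y"
  proof clarify
    fix z assume "z \<in> K"
    then show "g z \<in> Y" using Y y G Z(2) by (intro in_convex) blast+
  qed
  moreover have "\<exists>x\<in>K. \<exists>L\<in>G x. dist z x < \<epsilon> \<and> dist (g z) L < \<epsilon>" if z: "z \<in> K" for z
  proof -
    obtain x where x: "x \<in> K" "dist z x < \<epsilon>"
      "\<And>z' L. z' \<in> K \<Longrightarrow> dist z' z < \<eta> \<Longrightarrow> L \<in> G z' \<Longrightarrow> \<exists>L'\<in>G x. dist L L' < \<epsilon>"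
      using \<eta>(2)[OF z] by metis
    have "g z \<in> (\<Union>L\<in>G x. \<Union>e\<in>ball 0 \<epsilon>. {L + e})"
    proof (rule in_convex[OF z])
      show "convex (\<Union>L\<in>G x. \<Union>e\<in>ball 0 \<epsilon>. {L + e})"
        using G[OF x(1)] by (intro convex_sums) auto
      fix c assume "c \<in> Z" "dist c z < \<eta>"
      then obtain L' where "L' \<in> G x" "dist (y c) L' < \<epsilon>" using x(3) y Z(2) by blast
      then show "y c \<in> (\<Union>L\<in>G x. \<Union>e\<in>ball 0 \<epsilon>. {L + e})"
        by (intro UN_I[of L'] UN_I[of "y c - L'"]) (auto simp: dist_norm norm_minus_commute)
    qed
    then obtain L e where "L \<in> G x" "norm e < \<epsilon>" "g z = L + e" by auto
    then show ?thesis using x(1,2) by (intro bexI[of _ x] bexI[of _ L]) (auto simp: dist_norm)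
  qed
  ultimately show ?thesis by blast
qed

lemma continuous_map_in_graph_nbhd:
  fixes H :: "'a::metric_space \<Rightarrow> 'b::real_normed_vector set"
  assumes K: "compact K" and gr: "compact (gr K H)" and Y: "convex Y"
    and H: "\<And>x. x \<in> K \<Longrightarrow> H x \<noteq> {} \<and> convex (H x)"
    and \<Omega>: "openin (top_of_set (K \<times> Y)) \<Omega>" "gr K H \<subseteq> \<Omega>"
  shows "\<exists>h. continuous_on K h \<and> (\<forall>z\<in>K. (z, h z) \<in> \<Omega>)"
proof -
  obtain T where T: "open T" "\<Omega> = K \<times> Y \<inter> T" using \<Omega>(1) by (auto simp: openin_open)
  obtain \<epsilon> where \<epsilon>: "\<epsilon> > 0" "(\<Union>p\<in>gr K H. ball p \<epsilon>) \<subseteq> T"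
    using compact_subset_open_imp_ball_epsilon_subset[OF gr T(1)] \<Omega>(2) T(2) by blast
  have "H x \<noteq> {} \<and> convex (H x) \<and> H x \<subseteq> Y" if "x \<in> K" for x
    using that H \<Omega>(2) T(2) by (fastforce simp: gr_def)
  with K gr Y \<epsilon>(1) obtain h where h: "continuous_on K h" "h ` K \<subseteq> Y"
    "\<And>z. z \<in> K \<Longrightarrow> \<exists>x\<in>K. \<exists>L\<in>H x. dist z x < \<epsilon>/2 \<and> dist (h z) L < \<epsilon>/2"
    using cellina_approximation[of K H "\<epsilon>/2" Y] by auto
  have "(z, h z) \<in> \<Omega>" if z: "z \<in> K" for z
  proof -
    obtain x L where xL: "x \<in> K" "L \<in> H x" "dist z x < \<epsilon>/2" "dist (h z) L < \<epsilon>/2"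
      using h(3)[OF z] by blast
    have "dist (x, L) (z, h z) \<le> dist x z + dist L (h z)"
      unfolding dist_Pair_Pair by (rule sqrt_sum_squares_le_sum) auto
    also have "\<dots> < \<epsilon>" using xL by (simp add: dist_commute)
    finally have "(z, h z) \<in> T" using xL \<epsilon>(2) by (force simp: gr_def)
    then show ?thesis using T(2) z h(2) by auto
  qed
  with h(1) show ?thesis by blast
qed

text \<open>The criterion for CCA maps on which the theorem rests. Cellina's theorem turns the
  convex-valued map \<open>H\<close> near the graph of \<open>G\<close> into a continuous one. Since \<open>P\<close> is applied
  afterwards, the resulting map may have non-convex values, which is what makes room for a
  nonlinear change of coordinates.\<close>

proposition CCA_image:
  fixes G :: "'a::metric_space \<Rightarrow> 'b::real_normed_vector set"
    and P :: "'a \<times> 'b \<Rightarrow> 'c::metric_space"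
  assumes Y: "convex Y" and GY: "\<And>x. x \<in> X \<Longrightarrow> G x \<subseteq> Y"
    and P: "continuous_on (X \<times> Y) P" "P ` (X \<times> Y) \<subseteq> Y'"
    and gr: "\<And>K. compact K \<Longrightarrow> K \<subseteq> X \<Longrightarrow> compact (gr K G)"
    and approx: "\<And>K \<Omega>. \<lbrakk>compact K; K \<subseteq> X; openin (top_of_set (K \<times> Y)) \<Omega>; gr K G \<subseteq> \<Omega>\<rbrakk> \<Longrightarrow>
      \<exists>H. compact (gr K H) \<and> (\<forall>x\<in>K. H x \<noteq> {} \<and> convex (H x)) \<and> gr K H \<subseteq> \<Omega>"
  shows "CCA X Y' (\<lambda>x. (\<lambda>L. P (x, L)) ` G x)"
  unfolding CCA_def
proof (intro conjI allI impI ballI)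
  fix x assume "x \<in> X"
  then show "(\<lambda>L. P (x, L)) ` G x \<subseteq> Y'" using P(2) GY by blast
next
  let ?G = "\<lambda>x. (\<lambda>L. P (x, L)) ` G x"
  let ?Q = "\<lambda>p. (fst p, P p)"
  fix K assume K: "compact K \<and> K \<noteq> {} \<and> K \<subseteq> X"
  then have KY: "K \<times> Y \<subseteq> X \<times> Y" and grKY: "gr K G \<subseteq> K \<times> Y" using GY by (auto simp: gr_def)
  have Q: "continuous_on (K \<times> Y) ?Q" "?Q ` (K \<times> Y) \<subseteq> K \<times> Y'"
    using P KY by (auto intro!: continuous_intros intro: continuous_on_subset)
  have grQ: "gr K ?G = ?Q ` gr K G" by (force simp: gr_def)
  show cgr: "compact (gr K ?G)"
    unfolding grQ using K gr continuous_on_subset[OF Q(1) grKY] by (intro compact_continuous_image) auto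
  \<comment> \<open>By compactness of the graph, these neighbourhoods enter every other one; each is pulled back by
    \<open>?Q\<close> to \<open>K \<times> Y\<close>, where convex values and hence Cellina's theorem are available.\<close>
  let ?\<Omega> = "\<lambda>k. (K \<times> Y') \<inter> (\<Union>p\<in>gr K ?G. ball p (inverse (real (Suc k))))"
  have "\<exists>g. continuous_on K g \<and> (\<forall>z\<in>K. (z, g z) \<in> ?\<Omega> k)" for k
  proof -
    have open\<Omega>: "openin (top_of_set (K \<times> Y')) (?\<Omega> k)" by (intro openin_open_Int) auto
    let ?\<Omega>' = "(K \<times> Y) \<inter> ?Q -` ?\<Omega> k"
    have "openin (top_of_set (K \<times> Y)) ?\<Omega>'"
      using continuous_openin_preimage[OF Q(1) _ open\<Omega>] Q(2) by blast
    moreover have "gr K G \<subseteq> ?\<Omega>'"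
    proof
      fix p assume p: "p \<in> gr K G"
      then have "?Q p \<in> gr K ?G" "?Q p \<in> K \<times> Y'" using grQ grKY Q(2) by auto
      then have "?Q p \<in> ?\<Omega> k" by (intro IntI UN_I[of "?Q p"]) auto
      then show "p \<in> ?\<Omega>'" using p grKY by blast
    qed
    ultimately obtain H where "compact (gr K H)" "\<forall>x\<in>K. H x \<noteq> {} \<and> convex (H x)" "gr K H \<subseteq> ?\<Omega>'"
      using approx[of K ?\<Omega>'] K by blast
    then obtain h where h: "continuous_on K h" "\<forall>z\<in>K. (z, h z) \<in> ?\<Omega>'"
      using continuous_map_in_graph_nbhd[of K H Y ?\<Omega>'] K Y \<open>openin _ ?\<Omega>'\<close> by blast
    have "continuous_on K (\<lambda>z. P (z, h z))"
      using h P(1) K by (intro continuous_on_compose2[OF P(1)] continuous_intros) auto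
    then show ?thesis using h(2) by (intro exI[of _ "\<lambda>z. P (z, h z)"]) auto
  qed
  then have "\<forall>k. \<exists>g. continuous_on K g \<and> (\<forall>z\<in>K. (z, g z) \<in> ?\<Omega> k)" by blast
  from choice[OF this] obtain g where
    "\<forall>k. continuous_on K (g k) \<and> (\<forall>z\<in>K. (z, g k z) \<in> ?\<Omega> k)" by (elim exE)
  then have g: "\<And>k. continuous_on K (g k)" "\<And>k z. z \<in> K \<Longrightarrow> (z, g k z) \<in> ?\<Omega> k" by blast+
  show "\<exists>g. (\<forall>k. continuous_on K (g k) \<and> g k ` K \<subseteq> Y') \<and> inward_graph_converges K Y' (\<lambda>k x. {g k x}) ?G"
  proof (intro exI[of _ g] conjI allI)
    show "continuous_on K (g k)" "g k ` K \<subseteq> Y'" for k using g by auto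
    show "inward_graph_converges K Y' (\<lambda>k x. {g k x}) ?G"
      unfolding inward_graph_converges_def
    proof (intro allI impI)
      fix \<Omega> assume \<Omega>: "openin (top_of_set (K \<times> Y')) \<Omega> \<and> \<Omega> \<noteq> {} \<and> gr K ?G \<subseteq> \<Omega>"
      then obtain T where T: "open T" "\<Omega> = K \<times> Y' \<inter> T" by (auto simp: openin_open)
      obtain \<epsilon> where \<epsilon>: "\<epsilon> > 0" "(\<Union>p\<in>gr K ?G. ball p \<epsilon>) \<subseteq> T"
        using compact_subset_open_imp_ball_epsilon_subset[OF cgr T(1)] \<Omega> T(2) by blast
      obtain N where N: "inverse (real (Suc N)) < \<epsilon>" using reals_Archimedean[OF \<epsilon>(1)] by blast
      have "gr K (\<lambda>x. {g k x}) \<subseteq> \<Omega>" if "k \<ge> N" for k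
      proof
        fix p assume "p \<in> gr K (\<lambda>x. {g k x})"
        then obtain z where z: "z \<in> K" "p = (z, g k z)" by (auto simp: gr_def)
        have "inverse (real (Suc k)) \<le> inverse (real (Suc N))" using that by simp
        then have "inverse (real (Suc k)) \<le> \<epsilon>" using N by linarith
        then have "(\<Union>p\<in>gr K ?G. ball p (inverse (real (Suc k)))) \<subseteq> T"
          using \<epsilon>(2) subset_ball[of "inverse (real (Suc k))" \<epsilon>] by blast
        then show "p \<in> \<Omega>" using g(2)[OF z(1), of k] z(2) T(2) by blast
      qed
      then show "\<exists>N. \<forall>k\<ge>N. gr K (\<lambda>x. {g k x}) \<subseteq> \<Omega>" by blast
    qed
  qed
qed

section \<open>Charts and tangent spaces of \<open>C\<^sup>1\<close> manifolds\<close>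

lemma chart_inv_chart: "is_chart c \<Longrightarrow> p \<in> fst c \<Longrightarrow> chart_inv c (snd c p) = p"
  by (simp add: is_chart_def homeomorphism_def)

lemma chart_chart_inv: "is_chart c \<Longrightarrow> v \<in> snd c ` fst c \<Longrightarrow> snd c (chart_inv c v) = v"
  by (auto simp: is_chart_def homeomorphism_def)

lemma continuous_on_chart: "is_chart c \<Longrightarrow> continuous_on (fst c) (snd c)"
  by (simp add: is_chart_def homeomorphism_def)

lemma continuous_on_chart_inv: "is_chart c \<Longrightarrow> continuous_on (snd c ` fst c) (chart_inv c)"
  by (simp add: is_chart_def homeomorphism_def)

lemma open_chart_image:
  assumes c: "is_chart c" and W: "open W"
  shows "open (snd c ` (fst c \<inter> W))"
proof -
  have "homeomorphism (fst c) (snd c ` fst c) (snd c) (chart_inv c)" "open (snd c ` fst c)"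
    using c by (auto simp: is_chart_def)
  moreover have "openin (top_of_set (fst c)) (fst c \<inter> W)" using W by (rule openin_open_Int)
  ultimately show ?thesis
    using homeomorphism_imp_open_map openin_open_trans by blast
qed

definition transition_deriv ::
  "'a \<Rightarrow> ('a, 'e::real_normed_vector) chart \<Rightarrow> ('a, 'e) chart \<Rightarrow> 'e \<Rightarrow> 'e" where
  "transition_deriv p c c' = frechet_derivative (snd c' \<circ> chart_inv c) (at (snd c p))"

lemma C1_manifold_chart: "C1_manifold A \<Longrightarrow> c \<in> A \<Longrightarrow> is_chart c"
  by (simp add: C1_manifold_def)

lemma C1_manifold_finite_dim:
  "C1_manifold (A :: ('a::topological_space, 'e::real_inner) chart set) \<Longrightarrow>
     \<exists>B::'e set. finite B \<and> span B = UNIV"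
  by (simp add: C1_manifold_def)

lemma C1_manifold_transition:
  assumes "C1_manifold A" "c \<in> A" "c' \<in> A"
  shows "C1_on (snd c ` (fst c \<inter> fst c')) (snd c' \<circ> chart_inv c)"
  using assms unfolding C1_manifold_def C1_compatible_def by blast

lemma transition_has_derivative:
  assumes A: "C1_manifold A" "c \<in> A" "c' \<in> A" and p: "p \<in> fst c" "p \<in> fst c'"
  shows "((snd c' \<circ> chart_inv c) has_derivative transition_deriv p c c') (at (snd c p))"
proof -
  have "(snd c' \<circ> chart_inv c) differentiable (at (snd c p))"
    using C1_manifold_transition[OF A] p unfolding C1_on_def differentiable_def by blast
  then show ?thesis unfolding transition_deriv_def by (simp add: frechet_derivative_works)
qed

lemma transition_deriv_bounded_linear:
  "\<lbrakk>C1_manifold A; c \<in> A; c' \<in> A; p \<in> fst c; p \<in> fst c'\<rbrakk> \<Longrightarrow> bounded_linear (transition_deriv p c c')"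
  using transition_has_derivative by (rule has_derivative_bounded_linear)

text \<open>The chain rule for coordinate changes. It guarantees that a vector prescribed in one chart
  extends consistently to all the others.\<close>

lemma transition_deriv_cocycle:
  assumes A: "C1_manifold A" "c \<in> A" "c' \<in> A" "c'' \<in> A"
    and p: "p \<in> fst c" "p \<in> fst c'" "p \<in> fst c''"
  shows "transition_deriv p c' c'' (transition_deriv p c c' v) = transition_deriv p c c'' v"
proof -
  note ch = C1_manifold_chart[OF A(1)]
  have 1: "((snd c'' \<circ> chart_inv c') has_derivative transition_deriv p c' c'')
      (at ((snd c' \<circ> chart_inv c) (snd c p)))"
    using transition_has_derivative[OF A(1,3,4) p(2,3)] by (simp add: chart_inv_chart[OF ch] A p)
  have "((snd c'' \<circ> chart_inv c') \<circ> (snd c' \<circ> chart_inv c) has_derivative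
      transition_deriv p c' c'' \<circ> transition_deriv p c c') (at (snd c p))"
    by (rule diff_chain_at[OF transition_has_derivative[OF A(1-3) p(1,2)] 1])
  moreover have "open (snd c ` (fst c \<inter> fst c'))"
    using ch A by (intro open_chart_image) (auto simp: is_chart_def)
  ultimately have "((snd c'' \<circ> chart_inv c) has_derivative
      transition_deriv p c' c'' \<circ> transition_deriv p c c') (at (snd c p))"
    by (rule has_derivative_transform_within_open)
       (use p in \<open>auto simp: chart_inv_chart[OF ch[OF A(2)]] chart_inv_chart[OF ch[OF A(3)]]\<close>)
  then have "transition_deriv p c' c'' \<circ> transition_deriv p c c' = transition_deriv p c c''"
    using transition_has_derivative[OF A(1,2,4) p(1,3)] by (rule has_derivative_unique)
  then show ?thesis by (metis comp_apply)
qed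

lemma transition_deriv_refl:
  assumes A: "C1_manifold A" "c \<in> A" and p: "p \<in> fst c"
  shows "transition_deriv p c c v = v"
proof -
  note ch = C1_manifold_chart[OF A(1)]
  have "open (snd c ` fst c)" using ch A by (auto simp: is_chart_def)
  with has_derivative_ident have "((snd c \<circ> chart_inv c) has_derivative (\<lambda>v. v)) (at (snd c p))"
    by (rule has_derivative_transform_within_open)
       (use p in \<open>auto simp: chart_inv_chart[OF ch[OF A(2)]]\<close>)
  then have "transition_deriv p c c = (\<lambda>v. v)"
    using transition_has_derivative[OF A(1,2,2) p p] has_derivative_unique by blast
  then show ?thesis by simp
qed

lemma tangent_space_iff:
  "\<xi> \<in> tangent_space A p \<longleftrightarrow>
     (\<forall>c\<in>A. \<forall>c'\<in>A. p \<in> fst c \<and> p \<in> fst c' \<longrightarrow> \<xi> c' = transition_deriv p c c' (\<xi> c)) \<and>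
     (\<forall>c. \<not> (c \<in> A \<and> p \<in> fst c) \<longrightarrow> \<xi> c = 0)"
  by (simp add: tangent_space_def transition_deriv_def)

lemma tangent_space_eq_iff:
  assumes "c \<in> A" "p \<in> fst c" "\<xi> \<in> tangent_space A p" "\<eta> \<in> tangent_space A p"
  shows "\<xi> = \<eta> \<longleftrightarrow> \<xi> c = \<eta> c"
proof
  assume eq: "\<xi> c = \<eta> c"
  show "\<xi> = \<eta>"
  proof
    fix c' show "\<xi> c' = \<eta> c'"
      using assms eq unfolding tangent_space_iff by metis
  qed
qed simp

text \<open>An explicit formula for the inverse differential of a chart, obtained by transporting the
  component \<open>v\<close> to every other chart.\<close>

lemma dchart_inv_eq:
  assumes A: "C1_manifold A" "c \<in> A" and p: "p \<in> fst c"
  shows "dchart_inv A p c v = (\<lambda>c'. if c' \<in> A \<and> p \<in> fst c' then transition_deriv p c c' v else 0)"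
    (is "_ = ?\<tau>")
proof -
  have "?\<tau> \<in> tangent_space A p"
    using A p by (simp add: tangent_space_iff transition_deriv_cocycle)
  moreover have "?\<tau> c = v" using A p by (simp add: transition_deriv_refl)
  moreover have "inj_on (\<lambda>\<xi>. \<xi> c) (tangent_space A p)"
    using tangent_space_eq_iff[OF A(2) p] by (auto intro!: inj_onI)
  ultimately show ?thesis unfolding dchart_inv_def by (intro inv_into_f_eq) auto
qed

lemma dchart_inv_in_tangent_space:
  assumes A: "C1_manifold A" "c \<in> A" and p: "p \<in> fst c"
  shows "dchart_inv A p c v \<in> tangent_space A p"
  unfolding dchart_inv_eq[OF A p] using A p by (simp add: tangent_space_iff transition_deriv_cocycle)

lemma dchart_inv_component:
  assumes "C1_manifold A" "c \<in> A" "c' \<in> A" "p \<in> fst c" "p \<in> fst c'"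
  shows "dchart_inv A p c v c' = transition_deriv p c c' v"
  using assms by (simp add: dchart_inv_eq)

lemma dchart_inv_of_component:
  assumes "C1_manifold A" "c \<in> A" "p \<in> fst c" "\<xi> \<in> tangent_space A p"
  shows "dchart_inv A p c (\<xi> c) = \<xi>"
  unfolding tangent_space_eq_iff[OF assms(2,3) dchart_inv_in_tangent_space[OF assms(1-3)] assms(4)]
  using assms by (simp add: dchart_inv_component transition_deriv_refl)

lemma dchart_inv_change_chart:
  assumes "C1_manifold A" "c \<in> A" "c' \<in> A" "p \<in> fst c" "p \<in> fst c'"
  shows "dchart_inv A p c' (transition_deriv p c c' v) = dchart_inv A p c v"
  using dchart_inv_of_component[OF assms(1,3,5) dchart_inv_in_tangent_space[OF assms(1,2,4), of v]]
    dchart_inv_component[OF assms] by simp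

lemma dchart_inv_linear:
  assumes A: "C1_manifold A" "c \<in> A" and p: "p \<in> fst c"
  shows "dchart_inv A p c (a *\<^sub>R u + b *\<^sub>R v) =
    (\<lambda>c'. a *\<^sub>R dchart_inv A p c u c' + b *\<^sub>R dchart_inv A p c v c')"
proof
  fix c'
  show "dchart_inv A p c (a *\<^sub>R u + b *\<^sub>R v) c' =
    a *\<^sub>R dchart_inv A p c u c' + b *\<^sub>R dchart_inv A p c v c'"
  proof (cases "c' \<in> A \<and> p \<in> fst c'")
    case True
    then have "linear (transition_deriv p c c')"
      using bounded_linear.linear[OF transition_deriv_bounded_linear[OF A _ p, of c']] by blast
    with True A p show ?thesis by (simp add: dchart_inv_eq linear_add linear_scale)
  qed (use A p in \<open>auto simp: dchart_inv_eq\<close>)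
qed

text \<open>In finite dimension every linear map is bounded, so \<open>Blinfun\<close> returns the intended map and
  not its default value.\<close>

lemma lin_coord_apply:
  fixes A :: "('a::topological_space, 'e::real_inner) chart set"
  assumes A: "C1_manifold A" "c \<in> A" and p: "p \<in> fst c" and L: "L \<in> Lin_tangent A p"
  shows "blinfun_apply (lin_coord A p c L) v = L (dchart_inv A p c v)"
proof -
  have lin: "L (dchart_inv A p c (a *\<^sub>R u + b *\<^sub>R v)) =
      a *\<^sub>R L (dchart_inv A p c u) + b *\<^sub>R L (dchart_inv A p c v)" for a b u v
    unfolding dchart_inv_linear[OF A p]
    using L dchart_inv_in_tangent_space[OF A p] unfolding Lin_tangent_def by blast
  have "linear (\<lambda>v. L (dchart_inv A p c v))"
    using lin[of 1 _ 1] lin[of _ _ 0] by (intro linearI) simp_all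
  then have "bounded_linear (\<lambda>v. L (dchart_inv A p c v))"
    by (rule linear_imp_bounded_linear_finite_dim[OF C1_manifold_finite_dim[OF A(1)]])
  then show ?thesis unfolding lin_coord_def by (simp add: bounded_linear_Blinfun_apply)
qed

lemma lin_coord_change_chart:
  fixes A :: "('a::topological_space, 'e::real_inner) chart set"
  assumes A: "C1_manifold A" "c \<in> A" "c' \<in> A" and p: "p \<in> fst c" "p \<in> fst c'"
    and L: "L \<in> Lin_tangent A p"
  shows "lin_coord A p c L = lin_coord A p c' L o\<^sub>L Blinfun (transition_deriv p c c')"
  by (rule blinfun_eqI)
     (simp add: lin_coord_apply assms dchart_inv_change_chart
        bounded_linear_Blinfun_apply transition_deriv_bounded_linear[OF A p])

section \<open>Riemannian distance and coordinate distance\<close>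

text \<open>Uniqueness of one-sided derivatives with values in an arbitrary normed space, as needed for
  a model space that may have dimension 0.\<close>

lemma vector_derivative_unit_interval:
  fixes f :: "real \<Rightarrow> 'b::real_normed_vector"
  assumes "t \<in> {0..1}" "(f has_vector_derivative w) (at t within {0..1})"
  shows "vector_derivative f (at t within {0..1}) = w"
  using assms by (intro vector_derivative_within) (auto simp: trivial_limit_within islimpt_Icc)

lemma velocity_eq:
  assumes "C1_curve_in A W \<gamma>" "c \<in> A" "t \<in> {0..1}" "\<gamma> t \<in> fst c"
  shows "((snd c \<circ> \<gamma>) has_vector_derivative velocity A \<gamma> t c) (at t within {0..1})"
proof -
  obtain D where D: "((snd c \<circ> \<gamma>) has_vector_derivative D t) (at t within {0..1})"
    using assms unfolding C1_curve_in_def by blast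
  then show ?thesis
    using vector_derivative_unit_interval[OF assms(3) D] assms by (simp add: velocity_def)
qed

lemma velocity_eqI:
  assumes "c \<in> A" "t \<in> {0..1}" "\<gamma> t \<in> fst c"
    and "((snd c \<circ> \<gamma>) has_vector_derivative w) (at t within {0..1})"
  shows "velocity A \<gamma> t c = w"
  using vector_derivative_unit_interval[OF assms(2,4)] assms
  by (simp add: velocity_def)

text \<open>The chain rule along the curve, at interior points and at the end points alike. It makes the
  integrand of a curve length non-negative, so that the infimum of all lengths is bounded below.\<close>

lemma velocity_in_tangent_space:
  assumes A: "C1_manifold A" and \<gamma>: "C1_curve_in A W \<gamma>" and t: "t \<in> {0..1}"
  shows "velocity A \<gamma> t \<in> tangent_space A (\<gamma> t)"
proof -
  have "velocity A \<gamma> t c' = transition_deriv (\<gamma> t) c c' (velocity A \<gamma> t c)"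
    if c: "c \<in> A" "c' \<in> A" "\<gamma> t \<in> fst c" "\<gamma> t \<in> fst c'" for c c'
  proof (rule velocity_eqI[where \<gamma> = \<gamma>, OF c(2) t c(4)])
    have "open (fst c)" using C1_manifold_chart[OF A c(1)] by (simp add: is_chart_def)
    then obtain T where T: "open T" "T \<inter> {0..1} = \<gamma> -` fst c \<inter> {0..1}"
      using \<gamma> unfolding C1_curve_in_def continuous_on_open_invariant by metis
    then obtain d where d: "d > 0" "ball t d \<subseteq> T" using t c(3) open_contains_ball by blast
    have *: "((snd c' \<circ> chart_inv c) has_derivative transition_deriv (\<gamma> t) c c')
        (at ((snd c \<circ> \<gamma>) t) within (snd c \<circ> \<gamma>) ` {0..1})"
      using transition_has_derivative[OF A c] by (simp add: has_derivative_at_withinI)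
    have "((snd c' \<circ> chart_inv c) \<circ> (snd c \<circ> \<gamma>) has_vector_derivative
        transition_deriv (\<gamma> t) c c' (velocity A \<gamma> t c)) (at t within {0..1})"
      using vector_derivative_diff_chain_within[OF velocity_eq[OF \<gamma> c(1) t c(3)] *] .
    then show "(snd c' \<circ> \<gamma> has_vector_derivative
        transition_deriv (\<gamma> t) c c' (velocity A \<gamma> t c)) (at t within {0..1})"
      using d(1) t
    proof (rule has_vector_derivative_transform_within)
      fix s assume "s \<in> {0..1}" "dist s t < d"
      then have "s \<in> T \<inter> {0..1}" using d(2) by (auto simp: dist_commute subset_iff)
      then have "\<gamma> s \<in> fst c" unfolding T(2) by blast
      then show "((snd c' \<circ> chart_inv c) \<circ> (snd c \<circ> \<gamma>)) s = (snd c' \<circ> \<gamma>) s"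
        using chart_inv_chart[OF C1_manifold_chart[OF A c(1)]] by simp
    qed
  qed
  moreover have "\<forall>c. \<not> (c \<in> A \<and> \<gamma> t \<in> fst c) \<longrightarrow> velocity A \<gamma> t c = 0"
    by (simp add: velocity_def)
  ultimately show ?thesis unfolding tangent_space_iff by blast
qed

lemma riemannian_metric_nonneg:
  assumes g: "riemannian_metric_on A W g" and p: "p \<in> W" "\<xi> \<in> tangent_space A p"
  shows "0 \<le> g p \<xi> \<xi>"
proof (cases "\<xi> = (\<lambda>c. 0)")
  case True
  have "g p (\<lambda>c. 0 *\<^sub>R \<xi> c + 0 *\<^sub>R \<xi> c) \<xi> = 0 * g p \<xi> \<xi> + 0 * g p \<xi> \<xi>"
    using g p unfolding riemannian_metric_on_def by blast
  with True show ?thesis by simp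
next
  case False
  with assms show ?thesis unfolding riemannian_metric_on_def by (meson less_imp_le)
qed

lemma riemannian_metric_scale:
  assumes g: "riemannian_metric_on A W g" and A: "C1_manifold A" "c \<in> A"
    and p: "p \<in> W" "p \<in> fst c"
  shows "g p (dchart_inv A p c (a *\<^sub>R u)) (dchart_inv A p c (a *\<^sub>R u)) =
    a\<^sup>2 * g p (dchart_inv A p c u) (dchart_inv A p c u)"
proof -
  let ?\<tau> = "dchart_inv A p c"
  have T: "?\<tau> w \<in> tangent_space A p" for w using dchart_inv_in_tangent_space[OF A p(2)] .
  have eq: "?\<tau> (a *\<^sub>R u) = (\<lambda>c'. a *\<^sub>R ?\<tau> u c' + 0 *\<^sub>R ?\<tau> u c')"
    using dchart_inv_linear[OF A p(2), of a u 0 u] by simp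
  have 1: "g p (?\<tau> (a *\<^sub>R u)) (?\<tau> w) = a * g p (?\<tau> u) (?\<tau> w)" for w
  proof -
    have "g p (\<lambda>c'. a *\<^sub>R ?\<tau> u c' + 0 *\<^sub>R ?\<tau> u c') (?\<tau> w) = a * g p (?\<tau> u) (?\<tau> w) + 0 * g p (?\<tau> u) (?\<tau> w)"
      using g p(1) T[of u] T[of w] unfolding riemannian_metric_on_def by blast
    then show ?thesis unfolding eq by simp
  qed
  have "g p (?\<tau> u) (?\<tau> (a *\<^sub>R u)) = g p (?\<tau> (a *\<^sub>R u)) (?\<tau> u)"
    using g p(1) T unfolding riemannian_metric_on_def by blast
  then show ?thesis using 1[of "a *\<^sub>R u"] 1[of u] by (simp add: power2_eq_square)
qed

text \<open>Joint continuity of the metric coefficients at \<open>(p, 0, 0)\<close> bounds them by 1 for small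
  vectors near \<open>p\<close>, and homogeneity extends this to all vectors.\<close>

lemma riemannian_metric_locally_bounded:
  assumes g: "riemannian_metric_on A W g" and A: "C1_manifold A" "c \<in> A" and W: "open W"
    and p: "p \<in> W" "p \<in> fst c"
  shows "\<exists>N C. open N \<and> p \<in> N \<and> N \<subseteq> W \<inter> fst c \<and> C > 0 \<and>
    (\<forall>q\<in>N. \<forall>u. sqrt (g q (dchart_inv A q c u) (dchart_inv A q c u)) \<le> C * norm u)"
proof -
  let ?q = "\<lambda>(p, u, v). g p (dchart_inv A p c u) (dchart_inv A p c v)"
  have cont: "continuous_on ((W \<inter> fst c) \<times> UNIV \<times> UNIV) ?q"
    using g A unfolding riemannian_metric_on_def by blast
  have opn: "open (W \<inter> fst c)" using W C1_manifold_chart[OF A] by (auto simp: is_chart_def)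
  have q0: "?q (p, 0, 0) = 0" using riemannian_metric_scale[OF g A p, of 0 0] by simp
  define S where "S = ((W \<inter> fst c) \<times> UNIV \<times> UNIV) \<inter> ?q -` {..<1}"
  have "open S" unfolding S_def
    using opn by (intro continuous_open_preimage[OF cont] open_Times) auto
  moreover have "(p, 0, 0) \<in> S" using q0 p by (simp add: S_def)
  ultimately have "\<exists>N S2. open N \<and> open S2 \<and> (p, 0, 0) \<in> N \<times> S2 \<and> N \<times> S2 \<subseteq> S"
    unfolding open_prod_def[of S] by blast
  then obtain N S2 where N: "open N" "p \<in> N" "open S2" "(0, 0) \<in> S2" "N \<times> S2 \<subseteq> S" by auto
  have "\<exists>S3 S4. open S3 \<and> open S4 \<and> (0, 0) \<in> S3 \<times> S4 \<and> S3 \<times> S4 \<subseteq> S2"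
    using N(3,4) unfolding open_prod_def[of S2] by blast
  then obtain S3 S4 where S3: "open S3" "open S4" "0 \<in> S3" "0 \<in> S4" "S3 \<times> S4 \<subseteq> S2" by auto
  obtain e where e: "e > 0" "cball 0 e \<subseteq> S3 \<inter> S4"
    using open_contains_cball[of "S3 \<inter> S4"] S3 by (metis IntI open_Int)
  have le1: "g q (dchart_inv A q c u) (dchart_inv A q c u) \<le> 1"
    if q: "q \<in> N \<inter> (W \<inter> fst c)" and u: "norm u \<le> e" for q u
  proof -
    have "(u, u) \<in> S2" using u e(2) S3(5) by (auto simp: subset_iff)
    then have "(q, u, u) \<in> S" using q N(5) by auto
    then show ?thesis by (simp add: S_def)
  qed
  have "sqrt (g q (dchart_inv A q c u) (dchart_inv A q c u)) \<le> inverse e * norm u"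
    if q: "q \<in> N \<inter> (W \<inter> fst c)" for q u
  proof (cases "u = 0")
    case True
    then show ?thesis using riemannian_metric_scale[OF g A, of q 0 0] q by simp
  next
    case False
    \<comment> \<open>The rescaling of \<open>u\<close> to norm \<open>e\<close>.\<close>
    define w where "w = (e / norm u) *\<^sub>R u"
    have "u = (norm u / e) *\<^sub>R w" using False e(1) by (simp add: w_def)
    then have "g q (dchart_inv A q c u) (dchart_inv A q c u) =
        (norm u / e)\<^sup>2 * g q (dchart_inv A q c w) (dchart_inv A q c w)"
      using riemannian_metric_scale[OF g A, of q "norm u / e" w] q by simp
    also have "\<dots> \<le> (norm u / e)\<^sup>2 * 1"
      using q e(1) False by (intro mult_left_mono le1) (auto simp: w_def)
    finally have "sqrt (g q (dchart_inv A q c u) (dchart_inv A q c u)) \<le> sqrt ((norm u / e)\<^sup>2)"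
      by (intro real_sqrt_le_mono) simp
    then show ?thesis using e(1) by (simp add: divide_inverse mult.commute)
  qed
  then show ?thesis using N(1,2) p opn e(1)
    by (intro exI[of _ "N \<inter> (W \<inter> fst c)"] exI[of _ "inverse e"]) auto
qed

text \<open>The integrand is non-negative because velocities are tangent vectors, on which the metric is
  positive semi-definite; a non-integrable integrand has integral 0 by convention.\<close>

lemma curve_length_nonneg:
  assumes "C1_manifold A" "riemannian_metric_on A W g" "C1_curve_in A W \<gamma>"
  shows "0 \<le> curve_length A g \<gamma>"
proof -
  have "0 \<le> sqrt (g (\<gamma> t) (velocity A \<gamma> t) (velocity A \<gamma> t))" if "t \<in> {0..1}" for t
    using riemannian_metric_nonneg[OF assms(2) _ velocity_in_tangent_space[OF assms(1,3) that]]
      assms(3) that unfolding C1_curve_in_def by (simp add: image_subset_iff)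
  note nonneg = this
  show ?thesis
  proof (cases "(\<lambda>t. sqrt (g (\<gamma> t) (velocity A \<gamma> t) (velocity A \<gamma> t))) integrable_on {0..1}")
    case True
    then show ?thesis unfolding curve_length_def
      by (rule Henstock_Kurzweil_Integration.integral_nonneg) (rule nonneg)
  next
    case False
    then have "curve_length A g \<gamma> = 0" unfolding curve_length_def by (rule not_integrable_integral)
    then show ?thesis by simp
  qed
qed

lemma curve_length_le:
  assumes "\<And>t. t \<in> {0..1} \<Longrightarrow> sqrt (g (\<gamma> t) (velocity A \<gamma> t) (velocity A \<gamma> t)) \<le> b" "0 \<le> b"
  shows "curve_length A g \<gamma> \<le> b"
proof (cases "(\<lambda>t. sqrt (g (\<gamma> t) (velocity A \<gamma> t) (velocity A \<gamma> t))) integrable_on {0..1}")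
  case True
  have "curve_length A g \<gamma> \<le> integral {0..1} (\<lambda>t::real. b)"
    unfolding curve_length_def
  proof (rule Henstock_Kurzweil_Integration.integral_le)
    show "(\<lambda>t. sqrt (g (\<gamma> t) (velocity A \<gamma> t) (velocity A \<gamma> t))) integrable_on {0..1}"
      by (rule True)
    show "(\<lambda>t::real. b) integrable_on {0..1}" by (rule integrable_const_ivl)
    show "sqrt (g (\<gamma> t) (velocity A \<gamma> t) (velocity A \<gamma> t)) \<le> b" if "t \<in> {0..1}" for t
      by (rule assms(1)[OF that])
  qed
  also have "\<dots> = b" by simp
  finally show ?thesis .
next
  case False
  then have "curve_length A g \<gamma> = 0" unfolding curve_length_def by (rule not_integrable_integral)
  then show ?thesis using assms(2) by simp
qed

text \<open>The competitor for the infimum that defines the distance. It is differentiable in every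
  other chart, with continuous derivative, because coordinate changes are \<open>C\<^sup>1\<close>.\<close>

lemma coordinate_segment:
  assumes A: "C1_manifold A" "c \<in> A" and N: "N \<subseteq> W \<inter> fst c"
    and seg: "closed_segment u v \<subseteq> snd c ` N"
  defines "\<gamma> \<equiv> \<lambda>t. chart_inv c (u + t *\<^sub>R (v - u))"
  shows "C1_curve_in A W \<gamma>" "\<And>t. t \<in> {0..1} \<Longrightarrow> \<gamma> t \<in> N"
    "\<And>t. t \<in> {0..1} \<Longrightarrow> velocity A \<gamma> t = dchart_inv A (\<gamma> t) c (v - u)"
proof -
  note ch = C1_manifold_chart[OF A]
  define l where "l t = u + t *\<^sub>R (v - u)" for t
  have l: "l t \<in> snd c ` N" if "t \<in> {0..1}" for t
  proof -
    have "l t = (1 - t) *\<^sub>R u + t *\<^sub>R v" by (simp add: l_def algebra_simps)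
    then have "l t \<in> closed_segment u v" using that by (auto simp: in_segment)
    then show ?thesis using seg by blast
  qed
  have \<gamma>l: "\<gamma> t = chart_inv c (l t)" for t by (simp add: \<gamma>_def l_def)
  show \<gamma>N: "\<gamma> t \<in> N" if "t \<in> {0..1}" for t
    using l[OF that] N ch unfolding \<gamma>l by (auto simp: chart_inv_chart subset_iff)
  have c\<gamma>: "snd c (\<gamma> t) = l t" if "t \<in> {0..1}" for t
    using l[OF that] N ch unfolding \<gamma>l by (intro chart_chart_inv) auto
  have dl: "(l has_vector_derivative (v - u)) (at t within S)" for t S
    unfolding l_def has_vector_derivative_def by (auto intro!: derivative_eq_intros)
  have cont_l: "continuous_on {0..1} l" unfolding l_def by (intro continuous_intros)
  have "continuous_on {0..1} \<gamma>" unfolding \<gamma>l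
    by (rule continuous_on_compose2[OF continuous_on_chart_inv[OF ch] cont_l]) (use l N in blast)
  moreover have "\<exists>D. continuous_on {t\<in>{0..1}. \<gamma> t \<in> fst c'} D \<and>
      (\<forall>t\<in>{0..1}. \<gamma> t \<in> fst c' \<longrightarrow> ((snd c' \<circ> \<gamma>) has_vector_derivative D t) (at t within {0..1}))"
    if c': "c' \<in> A" for c'
  proof -
    obtain f' where f': "continuous_on (snd c ` (fst c \<inter> fst c')) f'"
      "\<And>x. x \<in> snd c ` (fst c \<inter> fst c') \<Longrightarrow>
        ((snd c' \<circ> chart_inv c) has_derivative blinfun_apply (f' x)) (at x)"
      using C1_manifold_transition[OF A c'] unfolding C1_on_def by blast
    have lc': "l t \<in> snd c ` (fst c \<inter> fst c')" if "t \<in> {0..1}" "\<gamma> t \<in> fst c'" for t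
      using c\<gamma>[OF that(1)] \<gamma>N[OF that(1)] that(2) N by (intro image_eqI[of _ _ "\<gamma> t"]) auto
    show ?thesis
    proof (intro exI[of _ "\<lambda>t. blinfun_apply (f' (l t)) (v - u)"] conjI ballI impI)
      have "continuous_on {t\<in>{0..1}. \<gamma> t \<in> fst c'} (\<lambda>t. f' (l t))"
        by (rule continuous_on_compose2[OF f'(1) continuous_on_subset[OF cont_l]]) (use lc' in auto)
      then show "continuous_on {t\<in>{0..1}. \<gamma> t \<in> fst c'} (\<lambda>t. blinfun_apply (f' (l t)) (v - u))"
        by (intro continuous_intros)
      fix t :: real assume t: "t \<in> {0..1}" "\<gamma> t \<in> fst c'"
      have "((snd c' \<circ> chart_inv c) \<circ> l has_vector_derivative blinfun_apply (f' (l t)) (v - u))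
          (at t within {0..1})"
        by (rule vector_derivative_diff_chain_within[OF dl has_derivative_at_withinI[OF f'(2)[OF lc'[OF t]]]])
      then show "((snd c' \<circ> \<gamma>) has_vector_derivative blinfun_apply (f' (l t)) (v - u)) (at t within {0..1})"
        by (simp add: o_def \<gamma>l)
    qed
  qed
  ultimately show C: "C1_curve_in A W \<gamma>" using \<gamma>N N unfolding C1_curve_in_def by blast
  show "velocity A \<gamma> t = dchart_inv A (\<gamma> t) c (v - u)" if t: "t \<in> {0..1}" for t
  proof -
    have \<gamma>c: "\<gamma> t \<in> fst c" using \<gamma>N[OF t] N by auto
    have "((snd c \<circ> \<gamma>) has_vector_derivative (v - u)) (at t within {0..1})"
      by (rule has_vector_derivative_transform[OF t _ dl]) (simp add: c\<gamma>)
    then have "velocity A \<gamma> t c = v - u" by (rule velocity_eqI[where \<gamma> = \<gamma>, OF A(2) t \<gamma>c])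
    then show ?thesis
      using dchart_inv_of_component[OF A \<gamma>c velocity_in_tangent_space[OF A(1) C t]] by simp
  qed
qed

text \<open>The distance is at most the length of the coordinate segment to \<open>p\<close>. This turns a growth
  condition in terms of \<open>d\<close> into one relative to the coordinate displacement.\<close>

theorem riemannian_distance_le_coordinate_distance:
  assumes A: "C1_manifold A" "c \<in> A" and d: "riemannian_distance_on A V d"
    and p: "p \<in> V" "p \<in> fst c"
  shows "\<exists>N C. open N \<and> p \<in> N \<and> C > 0 \<and>
    (\<forall>x\<in>N \<inter> V. x \<in> fst c \<and> 0 \<le> d x p \<and> d x p \<le> C * norm (snd c x - snd c p))"
proof -
  note ch = C1_manifold_chart[OF A]
  from d obtain W g where W: "open W" "V \<subseteq> W" "riemannian_metric_on A W g"
    and dW: "\<forall>x\<in>V. \<forall>y\<in>V. (\<exists>\<gamma>. C1_curve_in A W \<gamma> \<and> \<gamma> 0 = x \<and> \<gamma> 1 = y) \<and>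
      d x y = Inf {curve_length A g \<gamma> | \<gamma>. C1_curve_in A W \<gamma> \<and> \<gamma> 0 = x \<and> \<gamma> 1 = y}"
    unfolding riemannian_distance_on_def by blast
  have "p \<in> W" using p(1) W(2) by blast
  from riemannian_metric_locally_bounded[OF W(3) A W(1) this p(2)]
  obtain N C where N: "open N" "p \<in> N" "N \<subseteq> W \<inter> fst c" "C > 0"
    and gN: "\<forall>q\<in>N. \<forall>u. sqrt (g q (dchart_inv A q c u) (dchart_inv A q c u)) \<le> C * norm u"
    by blast
  have "open (snd c ` N)" using open_chart_image[OF ch N(1)] N(3) by (simp add: Int_absorb1)
  then obtain e where e: "e > 0" "ball (snd c p) e \<subseteq> snd c ` N"
    using N(2) open_contains_ball by blast
  have "openin (top_of_set (fst c)) (fst c \<inter> snd c -` ball (snd c p) e)"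
    using continuous_on_chart[OF ch] by (intro continuous_openin_preimage_gen) auto
  then have opn: "open (fst c \<inter> snd c -` ball (snd c p) e)"
    using ch openin_open_trans by (auto simp: is_chart_def)
  have main: "x \<in> fst c \<and> 0 \<le> d x p \<and> d x p \<le> C * norm (snd c x - snd c p)"
    if x: "x \<in> fst c" "snd c x \<in> ball (snd c p) e" "x \<in> V" for x
  proof -
    let ?Ls = "{curve_length A g \<gamma> | \<gamma>. C1_curve_in A W \<gamma> \<and> \<gamma> 0 = x \<and> \<gamma> 1 = p}"
    define \<gamma> where "\<gamma> t = chart_inv c (snd c x + t *\<^sub>R (snd c p - snd c x))" for t
    have seg: "closed_segment (snd c x) (snd c p) \<subseteq> snd c ` N"
      using e x(2) closed_segment_subset[OF _ _ convex_ball, of "snd c x" "snd c p" e "snd c p"] by auto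
    note cs = coordinate_segment[OF A N(3) seg, folded \<gamma>_def]
    have "\<gamma> 0 = x" "\<gamma> 1 = p" using x(1) p(2) by (auto simp: \<gamma>_def chart_inv_chart[OF ch])
    with cs(1) have L: "curve_length A g \<gamma> \<in> ?Ls" by blast
    have nonneg: "0 \<le> s" if "s \<in> ?Ls" for s
      using that curve_length_nonneg[OF A(1) W(3)] by auto
    have "curve_length A g \<gamma> \<le> C * norm (snd c p - snd c x)"
    proof (rule curve_length_le)
      fix t :: real assume "t \<in> {0..1}"
      then show "sqrt (g (\<gamma> t) (velocity A \<gamma> t) (velocity A \<gamma> t)) \<le> C * norm (snd c p - snd c x)"
        using cs(2,3) gN by simp
    qed (use N(4) in simp)
    moreover have "Inf ?Ls \<le> curve_length A g \<gamma>"
      by (rule cInf_lower[OF L bdd_belowI[OF nonneg]])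
    moreover have "0 \<le> Inf ?Ls" by (rule cInf_greatest) (use L nonneg in auto)
    ultimately show ?thesis using dW[rule_format, OF x(3) p(1)] x(1) by (simp add: norm_minus_commute)
  qed
  show ?thesis
    using opn p(2) e(1) N(4) main
    by (intro exI[of _ "fst c \<inter> snd c -` ball (snd c p) e"] exI[of _ C]) auto
qed

section \<open>Linear maps through prescribed points\<close>

text \<open>The rank one correction applied to the error at \<open>z\<close>. This is how the growth condition yields
  non-empty values of the approximating maps.\<close>

lemma linear_map_through_point:
  fixes z :: "'e::real_inner" and y :: "'f::real_normed_vector"
  assumes "norm (y - p - blinfun_apply L z) \<le> b * norm z" "0 \<le> b"
  shows "\<exists>E. norm E \<le> b \<and> p + blinfun_apply (L + E) z = y"
proof (intro exI conjI)
  let ?e = "y - p - blinfun_apply L z"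
  have "z = 0 \<Longrightarrow> ?e = 0" using assms(1) by simp
  then have "blinfun_apply (rank_one ?e (z /\<^sub>R (norm z)\<^sup>2)) z = ?e" by (rule rank_one_correction)
  then show "p + blinfun_apply (L + rank_one ?e (z /\<^sub>R (norm z)\<^sup>2)) z = y"
    by (simp add: blinfun.add_left)
  show "norm (rank_one ?e (z /\<^sub>R (norm z)\<^sup>2)) \<le> b"
    using assms by (rule norm_rank_one_correction_le)
qed

text \<open>The linear map \<open>M \<circ> L \<circ> N\<close> corrected in rank one so that its value at \<open>v\<close> is the true value
  \<open>k (y + L (h v))\<close> and not only its first-order approximation.\<close>

definition secant_map ::
  "('f::real_normed_vector \<Rightarrow> 'g::real_normed_vector) \<Rightarrow> ('f \<Rightarrow>\<^sub>L 'g) \<Rightarrow> 'f \<Rightarrow>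
     ('e::real_inner \<Rightarrow> 'c::real_normed_vector) \<Rightarrow> ('e \<Rightarrow>\<^sub>L 'c) \<Rightarrow> 'e \<times> ('c \<Rightarrow>\<^sub>L 'f) \<Rightarrow> 'e \<Rightarrow>\<^sub>L 'g" where
  "secant_map k M y h N = (\<lambda>(v, L). (M o\<^sub>L L o\<^sub>L N) +
     rank_one (k (y + blinfun_apply L (h v)) - blinfun_apply (M o\<^sub>L L o\<^sub>L N) v) (v /\<^sub>R (norm v)\<^sup>2))"

lemma secant_map_apply:
  assumes "k y = 0" "h 0 = 0"
  shows "blinfun_apply (secant_map k M y h N (v, L)) v = k (y + blinfun_apply L (h v))"
proof -
  let ?e = "k (y + blinfun_apply L (h v)) - blinfun_apply (M o\<^sub>L L o\<^sub>L N) v"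
  have "v = 0 \<Longrightarrow> ?e = 0" using assms by simp
  then have "blinfun_apply (rank_one ?e (v /\<^sub>R (norm v)\<^sup>2)) v = ?e" by (rule rank_one_correction)
  then show ?thesis by (simp add: secant_map_def blinfun.add_left)
qed

text \<open>The estimate in the proof of the chain rule for \<open>v \<mapsto> k (y + L (h v))\<close>, with constants that
  depend on \<open>L\<close> only through a bound on its norm.\<close>

lemma chain_rule_remainder_uniform:
  fixes M :: "'f::real_normed_vector \<Rightarrow>\<^sub>L 'g::real_normed_vector"
    and N :: "'e::real_normed_vector \<Rightarrow>\<^sub>L 'c::real_normed_vector"
  assumes k: "(k has_derivative blinfun_apply M) (at y)" "k y = 0"
    and h: "(h has_derivative blinfun_apply N) (at 0)" "h 0 = 0"
    and Y: "\<And>L. L \<in> Y \<Longrightarrow> norm L \<le> B" and \<epsilon>: "\<epsilon> > 0"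
  shows "\<forall>\<^sub>F v in nhds 0. \<forall>L\<in>Y.
    norm (k (y + blinfun_apply L (h v)) - blinfun_apply (M o\<^sub>L L o\<^sub>L N) v) \<le> \<epsilon> * norm v"
proof -
  \<comment> \<open>The remainder is split into that of \<open>k\<close> at \<open>L (h v)\<close> and the image under \<open>M \<circ> L\<close> of that of
    \<open>h\<close> at \<open>v\<close>; \<open>\<epsilon>1\<close> and \<open>\<epsilon>2\<close> make each contribute at most half. The minimum with 1 in \<open>\<epsilon>2\<close> ensures
    \<open>norm (h v) \<le> (norm N + 1) * norm v\<close>.\<close>
  define \<beta> where "\<beta> = max B 1"
  have \<beta>: "\<beta> > 0" "\<And>L. L \<in> Y \<Longrightarrow> norm L \<le> \<beta>" using Y by (auto simp: \<beta>_def le_max_iff_disj)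
  define \<epsilon>1 where "\<epsilon>1 = \<epsilon> / 2 / (\<beta> * (norm N + 1))"
  define \<epsilon>2 where "\<epsilon>2 = min 1 (\<epsilon> / 2 / (\<beta> * (norm M + 1)))"
  have nN: "norm N + 1 > 0" and nM: "norm M + 1 > 0" by (auto intro: add_nonneg_pos)
  have \<epsilon>12: "\<epsilon>1 > 0" "\<epsilon>2 > 0" using \<epsilon> \<beta> nN nM by (auto simp: \<epsilon>1_def \<epsilon>2_def)
  have \<epsilon>1N: "\<epsilon>1 * (\<beta> * (norm N + 1)) = \<epsilon> / 2"
    using \<epsilon>1_def mult_pos_pos[OF \<beta>(1) nN] by (metis less_irrefl nonzero_eq_divide_eq)
  have \<epsilon>2M: "\<epsilon>2 * (\<beta> * (norm M + 1)) \<le> \<epsilon> / 2"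
    using mult_pos_pos[OF \<beta>(1) nM] by (subst pos_le_divide_eq[symmetric]) (auto simp: \<epsilon>2_def)
  obtain d1 where d1: "d1 > 0" "\<And>z. norm z < d1 \<Longrightarrow> norm (k (y + z) - blinfun_apply M z) \<le> \<epsilon>1 * norm z"
  proof -
    from k obtain d where "d > 0" and d: "\<And>x. norm (x - y) < d \<Longrightarrow>
        norm (k x - k y - blinfun_apply M (x - y)) \<le> \<epsilon>1 * norm (x - y)"
      unfolding has_derivative_at_alt using \<epsilon>12(1) by meson
    have "norm (k (y + z) - blinfun_apply M z) \<le> \<epsilon>1 * norm z" if "norm z < d" for z
      using d[of "y + z"] that k(2) by simp
    then show ?thesis using that \<open>d > 0\<close> by blast
  qed
  obtain d2 where d2: "d2 > 0" "\<And>v. norm v < d2 \<Longrightarrow> norm (h v - blinfun_apply N v) \<le> \<epsilon>2 * norm v"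
  proof -
    from h obtain d where "d > 0" and d: "\<And>x. norm (x - 0) < d \<Longrightarrow>
        norm (h x - h 0 - blinfun_apply N (x - 0)) \<le> \<epsilon>2 * norm (x - 0)"
      unfolding has_derivative_at_alt using \<epsilon>12(2) by meson
    then show ?thesis using that h(2) by simp
  qed
  have hle: "norm (h v) \<le> (norm N + 1) * norm v" if "norm v < d2" for v
  proof -
    have "norm (h v) \<le> norm (h v - blinfun_apply N v) + norm (blinfun_apply N v)"
      using norm_triangle_ineq[of "h v - blinfun_apply N v" "blinfun_apply N v"] by simp
    also have "\<dots> \<le> \<epsilon>2 * norm v + norm N * norm v"
      using d2(2)[OF that] norm_blinfun by (intro add_mono)
    also have "\<dots> \<le> 1 * norm v + norm N * norm v"
      by (intro add_right_mono mult_right_mono) (auto simp: \<epsilon>2_def)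
    finally show ?thesis by (simp add: algebra_simps)
  qed
  define \<rho> where "\<rho> = min d2 (d1 / (\<beta> * (norm N + 1)))"
  have \<rho>: "\<rho> > 0" using d1(1) d2(1) \<beta>(1) nN by (simp add: \<rho>_def)
  have "norm (k (y + blinfun_apply L (h v)) - blinfun_apply (M o\<^sub>L L o\<^sub>L N) v) \<le> \<epsilon> * norm v"
    if v: "norm v < \<rho>" and L: "L \<in> Y" for v L
  proof -
    have v2: "norm v < d2" and v1: "norm v < d1 / (\<beta> * (norm N + 1))" using v by (auto simp: \<rho>_def)
    have Lh: "norm (blinfun_apply L (h v)) \<le> \<beta> * ((norm N + 1) * norm v)"
      using norm_blinfun[of L "h v"] mult_mono[OF \<beta>(2)[OF L] hle[OF v2]] \<beta>(1) by simp
    also have "\<dots> = norm v * (\<beta> * (norm N + 1))" by (simp only: mult_ac)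
    also have "\<dots> < d1" using v1 pos_less_divide_eq[OF mult_pos_pos[OF \<beta>(1) nN]] by blast
    finally have "norm (k (y + blinfun_apply L (h v)) - blinfun_apply M (blinfun_apply L (h v)))
        \<le> \<epsilon>1 * norm (blinfun_apply L (h v))" by (rule d1(2))
    also have "\<dots> \<le> \<epsilon>1 * (\<beta> * ((norm N + 1) * norm v))"
      using Lh \<epsilon>12(1) by (intro mult_left_mono) auto
    also have "\<dots> = \<epsilon>1 * (\<beta> * (norm N + 1)) * norm v" by (simp only: mult.assoc)
    also have "\<dots> = \<epsilon> / 2 * norm v" by (simp only: \<epsilon>1N)
    finally have 1: "norm (k (y + blinfun_apply L (h v)) - blinfun_apply M (blinfun_apply L (h v)))
        \<le> \<epsilon> / 2 * norm v" .
    have "norm (blinfun_apply M (blinfun_apply L (h v - blinfun_apply N v)))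
        \<le> norm M * (norm L * norm (h v - blinfun_apply N v))"
      by (rule order_trans[OF norm_blinfun mult_left_mono[OF norm_blinfun]]) simp
    also have "\<dots> \<le> (norm M + 1) * (\<beta> * (\<epsilon>2 * norm v))"
      using \<beta> L d2(2)[OF v2] by (intro mult_mono) auto
    also have "\<dots> = \<epsilon>2 * (\<beta> * (norm M + 1)) * norm v" by (simp only: mult_ac)
    also have "\<dots> \<le> \<epsilon> / 2 * norm v" by (rule mult_right_mono[OF \<epsilon>2M norm_ge_zero])
    finally have 2: "norm (blinfun_apply M (blinfun_apply L (h v - blinfun_apply N v))) \<le> \<epsilon> / 2 * norm v" .
    have "k (y + blinfun_apply L (h v)) - blinfun_apply (M o\<^sub>L L o\<^sub>L N) v =
        (k (y + blinfun_apply L (h v)) - blinfun_apply M (blinfun_apply L (h v))) +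
        blinfun_apply M (blinfun_apply L (h v - blinfun_apply N v))"
      by (simp add: blinfun.diff_right)
    also have "norm \<dots> \<le> \<epsilon> / 2 * norm v + \<epsilon> / 2 * norm v"
      by (rule norm_triangle_le[OF add_mono[OF 1 2]])
    finally show ?thesis by simp
  qed
  then show ?thesis unfolding eventually_nhds_metric using \<rho> by (intro exI[of _ \<rho>]) auto
qed

text \<open>Away from \<open>v = 0\<close> all ingredients are continuous. At \<open>v = 0\<close> the correction vanishes and,
  since the remainder is \<open>o(norm v)\<close> uniformly in \<open>L\<close>, it is small nearby.\<close>

lemma continuous_on_secant_map:
  assumes k: "(k has_derivative blinfun_apply M) (at y)" "k y = 0"
    and h: "(h has_derivative blinfun_apply N) (at 0)" "h 0 = 0"
    and Y: "\<And>L. L \<in> Y \<Longrightarrow> norm L \<le> B"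
    and hU: "continuous_on U h" and kD: "continuous_on D k"
    and D: "\<And>v L. v \<in> U \<Longrightarrow> L \<in> Y \<Longrightarrow> y + blinfun_apply L (h v) \<in> D"
  shows "continuous_on (U \<times> Y) (secant_map k M y h N)"
proof -
  let ?T = "\<lambda>p. M o\<^sub>L snd p o\<^sub>L N"
  let ?e = "\<lambda>p. k (y + blinfun_apply (snd p) (h (fst p))) - blinfun_apply (?T p) (fst p)"
  let ?R = "\<lambda>p. rank_one (?e p) (fst p /\<^sub>R (norm (fst p))\<^sup>2)"
  have T: "continuous_on (U \<times> Y) ?T" by (intro continuous_intros)
  have "continuous_on (U \<times> Y) (\<lambda>p. y + blinfun_apply (snd p) (h (fst p)))"
    by (intro continuous_intros continuous_on_compose2[OF hU]) auto
  then have "continuous_on (U \<times> Y) (\<lambda>p. k (y + blinfun_apply (snd p) (h (fst p))))"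
    by (rule continuous_on_compose2[OF kD]) (use D in auto)
  then have e: "continuous_on (U \<times> Y) ?e"
    by (intro continuous_intros T)
  have "(?R \<longlongrightarrow> ?R p) (at p within U \<times> Y)" if p: "p \<in> U \<times> Y" for p
  proof (cases "fst p = 0")
    case False
    have "((\<lambda>p. fst p /\<^sub>R (norm (fst p))\<^sup>2) \<longlongrightarrow> fst p /\<^sub>R (norm (fst p))\<^sup>2) (at p within U \<times> Y)"
      using False by (intro tendsto_intros) auto
    moreover have "(?e \<longlongrightarrow> ?e p) (at p within U \<times> Y)" using e p unfolding continuous_on_def by blast
    ultimately show ?thesis by (intro tendsto_rank_one)
  next
    case True
    have "(?R \<longlongrightarrow> 0) (at p within U \<times> Y)"
    proof (rule tendstoI)
      fix \<epsilon> :: real assume "\<epsilon> > 0"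
      then have "\<forall>\<^sub>F v in nhds 0. \<forall>L\<in>Y.
          norm (k (y + blinfun_apply L (h v)) - blinfun_apply (M o\<^sub>L L o\<^sub>L N) v) \<le> (\<epsilon>/2) * norm v"
        by (intro chain_rule_remainder_uniform[OF k h Y]) auto
      moreover have "filterlim fst (nhds 0) (at p within U \<times> Y)"
        using tendsto_fst[OF tendsto_ident_at, of p "U \<times> Y"] True by simp
      ultimately have "\<forall>\<^sub>F q in at p within U \<times> Y. \<forall>L\<in>Y.
          norm (k (y + blinfun_apply L (h (fst q))) - blinfun_apply (M o\<^sub>L L o\<^sub>L N) (fst q)) \<le> (\<epsilon>/2) * norm (fst q)"
        by (rule eventually_compose_filterlim)
      moreover have "\<forall>\<^sub>F q in at p within U \<times> Y. q \<in> U \<times> Y" by (simp add: eventually_at_filter)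
      ultimately show "\<forall>\<^sub>F q in at p within U \<times> Y. dist (?R q) 0 < \<epsilon>"
      proof eventually_elim
        case (elim q)
        then have "norm (?e q) \<le> (\<epsilon>/2) * norm (fst q)" by (metis mem_Times_iff)
        then have "norm (?R q) \<le> \<epsilon>/2"
          using \<open>\<epsilon> > 0\<close> by (intro norm_rank_one_correction_le) auto
        then show ?case using \<open>\<epsilon> > 0\<close> by (simp add: dist_norm)
      qed
    qed
    moreover have "?R p = 0" using True
      by (simp add: bounded_bilinear.zero_right[OF bounded_bilinear_rank_one])
    ultimately show ?thesis by simp
  qed
  then have "continuous_on (U \<times> Y) ?R" unfolding continuous_on_def by blast
  then have "continuous_on (U \<times> Y) (\<lambda>p. ?T p + ?R p)" using T by (intro continuous_intros)
  then show ?thesis by (simp add: secant_map_def case_prod_unfold)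
qed

lemma dist_secant_map_le:
  assumes "norm (k (y + blinfun_apply (L + E) (h v)) - blinfun_apply (M o\<^sub>L (L + E) o\<^sub>L N) v) \<le> b * norm v"
    and "0 \<le> b"
  shows "dist (secant_map k M y h N (v, L + E)) (M o\<^sub>L L o\<^sub>L N) \<le> norm M * norm N * norm E + b"
proof -
  let ?R = "rank_one (k (y + blinfun_apply (L + E) (h v)) - blinfun_apply (M o\<^sub>L (L + E) o\<^sub>L N) v) (v /\<^sub>R (norm v)\<^sup>2)"
  have "M o\<^sub>L (L + E) o\<^sub>L N = (M o\<^sub>L L o\<^sub>L N) + (M o\<^sub>L E o\<^sub>L N)"
    by (rule blinfun_eqI) (simp add: blinfun.add_left blinfun.add_right)
  moreover have "secant_map k M y h N (v, L + E) = (M o\<^sub>L (L + E) o\<^sub>L N) + ?R"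
    by (simp only: secant_map_def prod.case)
  ultimately have "secant_map k M y h N (v, L + E) - (M o\<^sub>L L o\<^sub>L N) = (M o\<^sub>L E o\<^sub>L N) + ?R"
    by (simp only: add.assoc add_diff_cancel_left')
  moreover have "norm (M o\<^sub>L E o\<^sub>L N) \<le> norm M * norm N * norm E"
    using order_trans[OF norm_blinfun_compose mult_right_mono[OF norm_blinfun_compose norm_ge_zero[of N]], of M E]
    by (simp add: mult_ac)
  moreover have "norm ?R \<le> b" using assms by (rule norm_rank_one_correction_le)
  ultimately show ?thesis unfolding dist_norm by (simp only: norm_triangle_le[OF add_mono])
qed

section \<open>The generalized differential quotient\<close>

lemma modulus_small:
  assumes "modulus \<omega>" "\<epsilon> > 0"
  shows "\<exists>\<sigma>>0. \<forall>s\<in>{0..\<sigma>}. \<omega> s \<le> \<epsilon>"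
proof -
  have lim: "(\<omega> \<longlongrightarrow> 0) (at_right 0)" and 0: "\<omega> 0 = 0" using assms(1) by (auto simp: modulus_def)
  have "\<forall>\<^sub>F s in at_right 0. \<omega> s < \<epsilon>" using order_tendstoD(2)[OF lim assms(2)] .
  then obtain b where b: "b > 0" "\<And>s. 0 < s \<Longrightarrow> s < b \<Longrightarrow> \<omega> s < \<epsilon>"
    unfolding eventually_at_right_field by auto
  have "\<omega> s \<le> \<epsilon>" if "s \<in> {0..b/2}" for s
    using that b(1) b(2)[of s] 0 assms(2) by (cases "s = 0") auto
  then show ?thesis using b(1) by (intro exI[of _ "b/2"]) auto
qed

lemma Inf_norm_attained:
  fixes T :: "'b::topological_space \<Rightarrow> 'f::real_normed_vector"
  assumes "compact S" "S \<noteq> {}" "continuous_on S T"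
  shows "\<exists>s\<in>S. norm (T s) \<le> Inf {norm (T s) | s. s \<in> S}"
proof -
  obtain s where s: "s \<in> S" "\<And>t. t \<in> S \<Longrightarrow> norm (T s) \<le> norm (T t)"
    using continuous_attains_inf[OF assms(1,2) continuous_on_norm[OF assms(3)]] by blast
  then have "norm (T s) \<le> Inf {norm (T s) | s. s \<in> S}" by (intro cInf_greatest) auto
  with s(1) show ?thesis by blast
qed

lemma standard_chart_has_derivative:
  assumes "k \<in> standard_charts" "y \<in> fst k"
  shows "(snd k has_derivative frechet_derivative (snd k) (at y)) (at y)"
proof -
  have "C1_compatible k (UNIV, id)" using assms(1) by (simp add: standard_charts_def)
  then have "C1_on (fst k) (snd k)"
    by (simp add: C1_compatible_def chart_inv_def)
  then have "snd k differentiable (at y)"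
    using assms(2) unfolding C1_on_def differentiable_def by blast
  then show ?thesis by (simp add: frechet_derivative_works)
qed

theorem theorem3p13:
  fixes A :: "('a::{t2_space, second_countable_topology}, 'e::real_inner) chart set"
    and F :: "'a \<Rightarrow> (real ^ 'm) set"
    and xs :: 'a and ys :: "real ^ 'm"
    and \<Lambda> :: "(('a, 'e) tvec \<Rightarrow> real ^ 'm) set"
    and V :: "'a set"
    and \<kappa> :: "('a, 'e) chart"
    and d :: "'a \<Rightarrow> 'a \<Rightarrow> real"
    and Fs :: "nat \<Rightarrow> 'a \<Rightarrow> (real ^ 'm) set"
    and \<omega> :: "nat \<Rightarrow> real \<Rightarrow> real" and \<omega>lim :: "real \<Rightarrow> real" and r :: real
  assumes manifold: "C1_manifold A"
    and F_usc: "usc_on UNIV F"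
    and F_values: "\<And>x. F x \<noteq> {} \<and> closed (F x)"
    and ys: "ys \<in> F xs"
    and \<Lambda>_Lin: "\<Lambda> \<subseteq> Lin_tangent A xs" and \<Lambda>_nonempty: "\<Lambda> \<noteq> {}"
    and V: "xs \<in> interior V"
    and chart: "\<kappa> \<in> A" "V \<subseteq> fst \<kappa>"
    and \<Lambda>_compact: "compact (lin_coord A xs \<kappa> ` \<Lambda>)"
    and \<Lambda>_convex: "convex (lin_coord A xs \<kappa> ` \<Lambda>)"
    and d: "riemannian_distance_on A V d"
    and Fs_usc: "\<And>j. usc_on V (Fs j)"
    and Fs_values: "\<And>j x. x \<in> V \<Longrightarrow> Fs j x \<noteq> {} \<and> compact (Fs j x) \<and> convex (Fs j x)"
    and Fs_conv: "inward_graph_converges V UNIV Fs F"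
    and ineq: "\<And>j x. x \<in> V \<Longrightarrow>
      Inf {norm (y - ys - blinfun_apply (lin_coord A xs \<kappa> L) (snd \<kappa> x - snd \<kappa> xs)) | y L.
             y \<in> Fs j x \<and> L \<in> \<Lambda>}
        \<le> d x xs * \<omega> j (d x xs)"
    and \<omega>_nonneg: "\<And>j s. s \<ge> 0 \<Longrightarrow> \<omega> j s \<ge> 0"
    and r: "r > 0"
    and \<omega>_conv: "uniform_limit {0..r} \<omega> \<omega>lim sequentially"
    and \<omega>lim: "modulus \<omega>lim"
  shows "manifold_GDQ A F xs ys UNIV \<Lambda>"
proof -
  note fin = C1_manifold_finite_dim[OF manifold]
  have xsV: "xs \<in> V" using V interior_subset by blast
  then have xs\<kappa>: "xs \<in> fst \<kappa>" using chart(2) by blast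
  note ch\<kappa> = C1_manifold_chart[OF manifold chart(1)]
  let ?\<Lambda> = "lin_coord A xs \<kappa> ` \<Lambda>"
  have "GDQ (chart_rep c k F) 0 0 (snd c ` (fst c \<inter> UNIV))
      ((\<lambda>L. Blinfun (frechet_derivative (snd k) (at ys)) o\<^sub>L lin_coord A xs c L) ` \<Lambda>)"
    if c: "c \<in> A" "xs \<in> fst c" "snd c xs = 0"
      and k: "k \<in> standard_charts" "ys \<in> fst k" "snd k ys = 0" for c and k :: "(real ^ 'm, real ^ 'm) chart"
  proof -
    note ch = C1_manifold_chart[OF manifold c(1)]
    have chk: "is_chart k" using k(1) by (simp add: standard_charts_def)
    define \<tau> where "\<tau> = chart_inv c"
    define h where "h v = snd \<kappa> (\<tau> v) - snd \<kappa> xs" for v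
    define N where "N = Blinfun (transition_deriv xs c \<kappa>)"
    define M where "M = Blinfun (frechet_derivative (snd k) (at ys))"
    define \<Lambda>' where "\<Lambda>' = (\<lambda>L. M o\<^sub>L L o\<^sub>L N) ` ?\<Lambda>"
    have \<tau>0: "\<tau> 0 = xs" using chart_inv_chart[OF ch c(2)] c(3) by (simp add: \<tau>_def)
    have h0: "h 0 = 0" by (simp add: h_def \<tau>0)
    \<comment> \<open>Passing from \<open>\<kappa>\<close> to \<open>c\<close> amounts to composition with the derivative \<open>N\<close> of \<open>\<kappa> \<circ> c\<^sup>-\<^sup>1\<close>.\<close>
    have \<Lambda>'_eq: "(\<lambda>L. M o\<^sub>L lin_coord A xs c L) ` \<Lambda> = \<Lambda>'"
      unfolding \<Lambda>'_def image_image
    proof (rule image_cong[OF refl])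
      fix L assume "L \<in> \<Lambda>"
      then have "lin_coord A xs c L = lin_coord A xs \<kappa> L o\<^sub>L N"
        unfolding N_def using \<Lambda>_Lin by (intro lin_coord_change_chart manifold c chart xs\<kappa>) auto
      then show "M o\<^sub>L lin_coord A xs c L = M o\<^sub>L lin_coord A xs \<kappa> L o\<^sub>L N"
        by (auto intro: blinfun_eqI)
    qed
    have derk: "(snd k has_derivative blinfun_apply M) (at ys)"
    proof -
      note D = standard_chart_has_derivative[OF k(1,2)]
      then show ?thesis
        by (simp add: M_def bounded_linear_Blinfun_apply[OF has_derivative_bounded_linear[OF D]])
    qed
    have derh: "(h has_derivative blinfun_apply N) (at 0)"
    proof -
      have D: "((snd \<kappa> \<circ> \<tau>) has_derivative transition_deriv xs c \<kappa>) (at 0)"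
        using transition_has_derivative[OF manifold c(1) chart(1) c(2) xs\<kappa>] c(3) by (simp add: \<tau>_def)
      then have "((\<lambda>v. (snd \<kappa> \<circ> \<tau>) v - snd \<kappa> xs) has_derivative transition_deriv xs c \<kappa>) (at 0)"
        using has_derivative_diff[OF D has_derivative_const[of "snd \<kappa> xs"]] by simp
      then show ?thesis
        using bounded_linear_Blinfun_apply[OF has_derivative_bounded_linear[OF D]]
        by (simp add: N_def h_def[abs_def])
    qed
    have "compact \<Lambda>'" unfolding \<Lambda>'_def
      by (intro compact_continuous_image \<Lambda>_compact continuous_intros)
    moreover have "\<Lambda>' \<noteq> {}" using \<Lambda>_nonempty by (simp add: \<Lambda>'_def)
    moreover have "0 \<in> chart_rep c k F 0"
      using c k ys \<tau>0 unfolding chart_rep_def \<tau>_def by (auto intro!: image_eqI[of 0 _ ys] image_eqI[of 0 _ xs])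
    moreover have "\<exists>U G. compact U \<and> 0 \<in> interior U \<and>
        compact ((\<lambda>u. 0 + u) ` U \<inter> snd c ` (fst c \<inter> UNIV)) \<and>
        CCA ((\<lambda>u. 0 + u) ` U \<inter> snd c ` (fst c \<inter> UNIV)) {A. infdist A \<Lambda>' \<le> \<delta>} G \<and>
        (\<forall>x\<in>(\<lambda>u. 0 + u) ` U \<inter> snd c ` (fst c \<inter> UNIV). \<forall>L\<in>G x.
           0 + blinfun_apply L (x - 0) \<in> chart_rep c k F x)" if \<delta>: "\<delta> > 0" for \<delta>
    proof -
      \<comment> \<open>One half of \<open>\<delta>\<close> pays for the radius \<open>\<delta>1\<close> of \<open>Y\<close> after composition with \<open>M\<close> and \<open>N\<close>, the other
        half for the rank one correction in \<open>secant_map\<close>.\<close>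
      define \<delta>1 where "\<delta>1 = \<delta> / 2 / (norm M * norm N + 1)"
      have MN: "norm M * norm N + 1 > 0" by (simp add: add_nonneg_pos)
      have \<delta>1: "\<delta>1 > 0" using \<delta> MN by (simp add: \<delta>1_def)
      have MN\<delta>1: "norm M * norm N * \<delta>1 \<le> \<delta> / 2"
      proof -
        have "\<delta>1 * (norm M * norm N + 1) = \<delta> / 2"
          using MN unfolding \<delta>1_def by (metis less_irrefl nonzero_eq_divide_eq)
        then show ?thesis using \<delta>1 by (simp add: algebra_simps)
      qed
      define Y where "Y = {L + E | L E. L \<in> ?\<Lambda> \<and> E \<in> cball 0 \<delta>1}"
      have Y_compact: "compact Y" unfolding Y_def
        by (intro compact_sums \<Lambda>_compact compact_cball_blinfun_finite_dim[OF fin])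
      have "Y = (\<Union>L\<in>?\<Lambda>. \<Union>E\<in>cball 0 \<delta>1. {L + E})" unfolding Y_def by blast
      then have Y_convex: "convex Y" using convex_sums[OF \<Lambda>_convex convex_cball] by simp
      obtain B where B: "\<And>L. L \<in> Y \<Longrightarrow> norm L \<le> B"
        using compact_imp_bounded[OF Y_compact] unfolding bounded_iff by blast
      obtain W C where W: "open W" "xs \<in> W" and C: "C > 0"
        and dW: "\<forall>x\<in>W \<inter> V. x \<in> fst \<kappa> \<and> 0 \<le> d x xs \<and> d x xs \<le> C * norm (snd \<kappa> x - snd \<kappa> xs)"
        using riemannian_distance_le_coordinate_distance[OF manifold chart(1) d xsV xs\<kappa>] by blast
      \<comment> \<open>Half of the bound \<open>\<delta>1 / C\<close> is for the limit modulus, half for the deviation of \<open>\<omega> j\<close> from it.\<close>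
      have \<delta>C: "\<delta>1 / (2 * C) > 0" using \<delta>1 C by simp
      obtain \<sigma> where \<sigma>: "\<sigma> > 0" "\<And>s. s \<in> {0..\<sigma>} \<Longrightarrow> \<omega>lim s \<le> \<delta>1 / (2 * C)"
        using modulus_small[OF \<omega>lim \<delta>C] by blast
      obtain J0 where J0: "\<And>j s. j \<ge> J0 \<Longrightarrow> s \<in> {0..r} \<Longrightarrow> dist (\<omega> j s) (\<omega>lim s) < \<delta>1 / (2 * C)"
        using uniform_limitD[OF \<omega>_conv \<delta>C] unfolding eventually_sequentially by blast
      have \<omega>_small: "\<omega> j s \<le> \<delta>1 / C" if "j \<ge> J0" "0 \<le> s" "s \<le> min \<sigma> r" for j s
      proof -
        have "\<omega> j s < \<omega>lim s + \<delta>1 / (2 * C)" using J0[of j s] that by (auto simp: dist_real_def)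
        also have "\<dots> \<le> \<delta>1 / (2 * C) + \<delta>1 / (2 * C)" using \<sigma>(2)[of s] that by simp
        finally show ?thesis using C by (simp add: field_simps)
      qed

      define D where "D = snd c ` (fst c \<inter> (fst \<kappa> \<inter> interior V \<inter> W))"
      have D_open: "open D" unfolding D_def
        using ch\<kappa> W(1) by (intro open_chart_image ch open_Int) (auto simp: is_chart_def)
      have D0: "0 \<in> D" unfolding D_def using c xs\<kappa> V W(2) by (intro image_eqI[of _ _ xs]) auto
      have \<tau>D: "\<tau> v \<in> V" "\<tau> v \<in> W" "\<tau> v \<in> fst \<kappa>" "v \<in> snd c ` fst c" if "v \<in> D" for v
        using that interior_subset[of V] unfolding D_def \<tau>_def by (auto simp: chart_inv_chart[OF ch])
      have \<tau>_cont: "continuous_on D \<tau>"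
        unfolding \<tau>_def using \<tau>D(4) by (intro continuous_on_subset[OF continuous_on_chart_inv[OF ch]]) auto
      have h_cont: "continuous_on D h" unfolding h_def
        by (intro continuous_intros continuous_on_compose2[OF continuous_on_chart[OF ch\<kappa>] \<tau>_cont]) (use \<tau>D in auto)
      obtain e where e: "e > 0" "ball ys e \<subseteq> fst k"
        using chk k(2) open_contains_ball unfolding is_chart_def by blast
      \<comment> \<open>The first bound keeps the distance to \<open>xs\<close> in the range where \<open>\<omega> j\<close> is small, the second keeps
        \<open>ys + L (h v)\<close> in the domain of \<open>k\<close>.\<close>
      define \<eta> where "\<eta> = min (min \<sigma> r / C) (e / (\<bar>B\<bar> + 1))"
      have \<eta>: "\<eta> > 0" using \<sigma>(1) r C e(1) by (simp add: \<eta>_def)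
      have "(h \<longlongrightarrow> h 0) (nhds 0)"
        using has_derivative_continuous[OF derh] unfolding isCont_def tendsto_at_iff_tendsto_nhds .
      from tendstoD[OF this \<eta>] have ev_h: "\<forall>\<^sub>F v in nhds 0. norm (h v) < \<eta>"
        unfolding h0 dist_norm by simp
      have ev_D: "\<forall>\<^sub>F v in nhds 0. v \<in> D" using D_open D0 by (rule eventually_nhds_in_open)
      have ev_rem: "\<forall>\<^sub>F v in nhds 0. \<forall>L\<in>Y.
          norm (snd k (ys + blinfun_apply L (h v)) - blinfun_apply (M o\<^sub>L L o\<^sub>L N) v) \<le> (\<delta>/2) * norm v"
        using \<delta> by (intro chain_rule_remainder_uniform[OF derk k(3) derh h0 B]) auto
      from eventually_conj[OF ev_D eventually_conj[OF ev_h ev_rem]]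
      obtain \<rho>' where "\<rho>' > 0" and \<rho>': "\<And>v. dist v 0 < \<rho>' \<Longrightarrow> v \<in> D \<and> norm (h v) < \<eta> \<and> (\<forall>L\<in>Y.
          norm (snd k (ys + blinfun_apply L (h v)) - blinfun_apply (M o\<^sub>L L o\<^sub>L N) v) \<le> (\<delta>/2) * norm v)"
        unfolding eventually_nhds_metric by blast
      define U where "U = cball (0::'e) (\<rho>' / 2)"
      have U: "v \<in> D" "norm (h v) < \<eta>" if "v \<in> U" for v
        using \<rho>'[of v] that \<open>\<rho>' > 0\<close> by (auto simp: U_def)
      have rem: "norm (snd k (ys + blinfun_apply L (h v)) - blinfun_apply (M o\<^sub>L L o\<^sub>L N) v) \<le> (\<delta>/2) * norm v"
        if "v \<in> U" "L \<in> Y" for v L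
        using \<rho>'[of v] that \<open>\<rho>' > 0\<close> by (auto simp: U_def)
      have U_compact: "compact U" unfolding U_def by (rule compact_cball_finite_dim[OF fin])
      have U0: "0 \<in> interior U" using \<open>\<rho>' > 0\<close> by (auto simp: U_def intro!: interiorI[of "ball 0 (\<rho>'/2)"])
      have U_eq: "(\<lambda>u. 0 + u) ` U \<inter> snd c ` (fst c \<inter> UNIV) = U" using U(1) \<tau>D(4) by auto
      have in_k: "ys + blinfun_apply L (h v) \<in> fst k" if "v \<in> U" "L \<in> Y" for v L
      proof -
        have "norm (blinfun_apply L (h v)) \<le> norm L * norm (h v)" by (rule norm_blinfun)
        also have "\<dots> \<le> (\<bar>B\<bar> + 1) * norm (h v)" using B[OF that(2)] by (intro mult_right_mono) auto
        also have "\<dots> < (\<bar>B\<bar> + 1) * (e / (\<bar>B\<bar> + 1))"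
          using U(2)[OF that(1)] by (intro mult_strict_left_mono) (auto simp: \<eta>_def)
        also have "\<dots> = e" by simp
        finally show ?thesis using e(2) by (auto simp: dist_norm)
      qed

      let ?P = "secant_map (snd k) M ys h N"
      define q where "q p = (\<tau> (fst p), ys + blinfun_apply (snd p) (h (fst p)))" for p
      \<comment> \<open>The maps \<open>G\<close> and \<open>H\<close> of the introduction are \<open>fib F\<close> and \<open>fib (Fs j)\<close>.\<close>
      define fib where "fib \<Phi> v = {L \<in> Y. ys + blinfun_apply L (h v) \<in> \<Phi> (\<tau> v)}" for \<Phi> :: "'a \<Rightarrow> (real ^ 'm) set" and v
      have gr_fib: "gr K (fib \<Phi>) = {p \<in> K \<times> Y. q p \<in> gr V \<Phi>}" if "K \<subseteq> U" for K \<Phi>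
        using that U(1) \<tau>D(1) by (auto simp: gr_def fib_def q_def)
      have q_cont: "continuous_on (K \<times> Y) q" "q ` (K \<times> Y) \<subseteq> V \<times> UNIV" if "K \<subseteq> U" for K
      proof -
        have KD: "K \<subseteq> D" using that U(1) by blast
        show "continuous_on (K \<times> Y) q" unfolding q_def
          by (intro continuous_intros continuous_on_compose2[OF continuous_on_subset[OF \<tau>_cont KD]]
                continuous_on_compose2[OF continuous_on_subset[OF h_cont KD]]) auto
        show "q ` (K \<times> Y) \<subseteq> V \<times> UNIV" using KD \<tau>D(1) by (auto simp: q_def)
      qed
      have "CCA U {A. infdist A \<Lambda>' \<le> \<delta>} (\<lambda>v. (\<lambda>L. ?P (v, L)) ` fib F v)"
      proof (rule CCA_image[OF Y_convex])
        show "fib F v \<subseteq> Y" for v by (auto simp: fib_def)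
        show "continuous_on (U \<times> Y) ?P"
          by (rule continuous_on_secant_map[OF derk k(3) derh h0 B _ continuous_on_chart[OF chk]])
             (use in_k U(1) h_cont in \<open>auto intro: continuous_on_subset\<close>)
        show "?P ` (U \<times> Y) \<subseteq> {A. infdist A \<Lambda>' \<le> \<delta>}"
        proof clarsimp
          fix v L assume v: "v \<in> U" and L: "L \<in> Y"
          obtain L0 E where LE: "L = L0 + E" "L0 \<in> ?\<Lambda>" "norm E \<le> \<delta>1" using L by (auto simp: Y_def)
          have "dist (?P (v, L)) (M o\<^sub>L L0 o\<^sub>L N) \<le> norm M * norm N * norm E + \<delta> / 2"
            unfolding LE(1) using rem[OF v L] \<delta> unfolding LE(1) by (intro dist_secant_map_le) auto
          also have "\<dots> \<le> norm M * norm N * \<delta>1 + \<delta> / 2"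
            using LE(3) by (intro add_right_mono mult_left_mono) auto
          also have "\<dots> \<le> \<delta>" using MN\<delta>1 by simp
          finally have "dist (?P (v, L)) (M o\<^sub>L L0 o\<^sub>L N) \<le> \<delta>" .
          moreover have "M o\<^sub>L L0 o\<^sub>L N \<in> \<Lambda>'" using LE(2) by (auto simp: \<Lambda>'_def)
          ultimately show "infdist (?P (v, L)) \<Lambda>' \<le> \<delta>" by (rule infdist_le2[rotated])
        qed
        fix K assume K: "compact K" "K \<subseteq> U"
        have cl: "closedin (top_of_set (V \<times> UNIV)) (gr V F)"
          using usc_on_subset[OF F_usc] F_values by (intro closedin_graph_of_usc) auto
        show "compact (gr K (fib F))"
          unfolding gr_fib[OF K(2)] by (rule compact_graph_pullback[OF K(1) Y_compact q_cont[OF K(2)] cl])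
        fix \<Omega> assume \<Omega>: "openin (top_of_set (K \<times> Y)) \<Omega>" "gr K (fib F) \<subseteq> \<Omega>"
        have ne: "gr V F \<noteq> {}" using xsV ys by (auto simp: gr_def)
        obtain J where J: "\<And>j. j \<ge> J \<Longrightarrow> {p \<in> K \<times> Y. q p \<in> gr V (Fs j)} \<subseteq> \<Omega>"
          using inward_graph_converges_pullback[OF Fs_conv ne K(1) Y_compact q_cont(1)[OF K(2)] \<Omega>(1)]
            \<Omega>(2) gr_fib[OF K(2), of F] by auto
        define j where "j = max J J0"
        have "compact (gr K (fib (Fs j)))"
          unfolding gr_fib[OF K(2)]
          by (rule compact_graph_pullback[OF K(1) Y_compact q_cont[OF K(2)]])
             (use Fs_usc Fs_values in \<open>auto intro!: closedin_graph_of_usc intro: compact_imp_closed\<close>)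
        moreover have "gr K (fib (Fs j)) \<subseteq> \<Omega>"
          unfolding gr_fib[OF K(2)] by (rule J) (simp add: j_def)
        moreover have "fib (Fs j) v \<noteq> {} \<and> convex (fib (Fs j) v)" if "v \<in> K" for v
        proof
          have v: "v \<in> U" using that K(2) by blast
          note vD = \<tau>D[OF U(1)[OF v]]
          note vals = Fs_values[OF vD(1), of j]
          have dv: "0 \<le> d (\<tau> v) xs" "d (\<tau> v) xs \<le> C * norm (h v)" using dW vD(1,2) by (auto simp: h_def)
          have "C * norm (h v) \<le> C * (min \<sigma> r / C)"
            using U(2)[OF v] C by (intro mult_left_mono) (auto simp: \<eta>_def)
          then have "d (\<tau> v) xs \<le> min \<sigma> r" using dv(2) C by simp
          then have \<omega>v: "\<omega> j (d (\<tau> v) xs) \<le> \<delta>1 / C" using dv(1) by (intro \<omega>_small) (auto simp: j_def)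
          \<comment> \<open>The growth condition yields a pair with error at most \<open>\<delta>1 * norm (h v)\<close>, which a correction
            \<open>E\<close> of norm at most \<open>\<delta>1\<close> removes. At \<open>v = 0\<close> the error is 0.\<close>
          let ?T = "\<lambda>p. fst p - ys - blinfun_apply (snd p) (h v)"
          have "compact (Fs j (\<tau> v) \<times> ?\<Lambda>)" "Fs j (\<tau> v) \<times> ?\<Lambda> \<noteq> {}"
            using vals \<Lambda>_compact \<Lambda>_nonempty by (auto intro: compact_Times)
          moreover have "continuous_on (Fs j (\<tau> v) \<times> ?\<Lambda>) ?T" by (intro continuous_intros)
          ultimately have "\<exists>p\<in>Fs j (\<tau> v) \<times> ?\<Lambda>.
              norm (?T p) \<le> Inf {norm (?T p) | p. p \<in> Fs j (\<tau> v) \<times> ?\<Lambda>}"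
            by (rule Inf_norm_attained)
          then obtain p where p: "p \<in> Fs j (\<tau> v) \<times> ?\<Lambda>"
            and inf: "norm (?T p) \<le> Inf {norm (?T p) | p. p \<in> Fs j (\<tau> v) \<times> ?\<Lambda>}" ..
          define y L where "y = fst p" and "L = snd p"
          have yL: "y \<in> Fs j (\<tau> v)" "L \<in> ?\<Lambda>" using p by (auto simp: y_def L_def)
          have "{norm (?T p) | p. p \<in> Fs j (\<tau> v) \<times> ?\<Lambda>} =
              {norm (y - ys - blinfun_apply (lin_coord A xs \<kappa> L) (snd \<kappa> (\<tau> v) - snd \<kappa> xs)) | y L.
                 y \<in> Fs j (\<tau> v) \<and> L \<in> \<Lambda>}" (is "?S = ?S'") unfolding h_def by force
          then have "norm (?T p) \<le> Inf ?S'" using inf by (rule subst)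
          also have "\<dots> \<le> d (\<tau> v) xs * \<omega> j (d (\<tau> v) xs)" by (rule ineq[OF vD(1)])
          finally have "norm (y - ys - blinfun_apply L (h v)) \<le> d (\<tau> v) xs * \<omega> j (d (\<tau> v) xs)"
            unfolding y_def L_def .
          also have "\<dots> \<le> (C * norm (h v)) * (\<delta>1 / C)"
            using dv \<omega>v \<omega>_nonneg[OF dv(1)] C by (intro mult_mono) auto
          also have "\<dots> = \<delta>1 * norm (h v)" using C by simp
          finally obtain E where "norm E \<le> \<delta>1" "ys + blinfun_apply (L + E) (h v) = y"
            using linear_map_through_point \<delta>1 by (metis less_imp_le)
          then have "L + E \<in> fib (Fs j) v" using yL by (auto simp: fib_def Y_def)
          then show "fib (Fs j) v \<noteq> {}" by blast
          \<comment> \<open>Convexity: the constraint is affine in \<open>L\<close>.\<close>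
          have "linear (\<lambda>L. blinfun_apply L (h v))"
            by (intro bounded_linear.linear blinfun.bounded_linear_left)
          then have "convex ((\<lambda>L. blinfun_apply L (h v)) -` ((\<lambda>y. - ys + y) ` Fs j (\<tau> v)))"
            using vals by (intro convex_linear_vimage convex_translation) auto
          moreover have "fib (Fs j) v = Y \<inter> (\<lambda>L. blinfun_apply L (h v)) -` ((\<lambda>y. - ys + y) ` Fs j (\<tau> v))"
            by (force simp: fib_def image_iff)
          ultimately show "convex (fib (Fs j) v)" using Y_convex by (simp add: convex_Int)
        qed
        ultimately show "\<exists>H. compact (gr K H) \<and> (\<forall>x\<in>K. H x \<noteq> {} \<and> convex (H x)) \<and> gr K H \<subseteq> \<Omega>" by blast
      qed
      moreover have "blinfun_apply (?P (v, L)) v \<in> chart_rep c k F v" if "v \<in> U" "L \<in> fib F v" for v L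
      proof -
        have "ys + blinfun_apply L (h v) \<in> F (\<tau> v) \<inter> fst k" using that in_k by (auto simp: fib_def)
        then show ?thesis
          using \<tau>D(4)[OF U(1)[OF that(1)]]
          by (simp add: chart_rep_def secant_map_apply[of "snd k" ys h, OF k(3) h0] \<tau>_def)
      qed
      ultimately show ?thesis using U_compact U0
        by (intro exI[of _ U] exI[of _ "\<lambda>v. (\<lambda>L. ?P (v, L)) ` fib F v"], unfold U_eq) auto
    qed
    ultimately show ?thesis
      unfolding GDQ_def M_def[symmetric] \<Lambda>'_eq using c(2) by blast
  qed
  then show ?thesis unfolding manifold_GDQ_def using ys \<Lambda>_Lin by blast
qed

end
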